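(* There is no gradient Ricci soliton warped product $(B^n\times_f F^m,g,\nabla\tilde\varphi,\lambda)$ (with any $\lambda\in\mathbb{R}$ and $\varphi\in C^\infty(B)$) such that the base $B$ is compact, the warping function $f$ is non-constant, and the fiber $F$ is a Riemannian manifold of dimension $m\ge 2$ with non-positive scalar curvature.
   Context: Manifolds are smooth, connected and without boundary. Given Riemannian manifolds $(B^n,g_B)$, $(F^m,g_F)$ of dimensions $n,m$ and a positive smooth function $f$ on $B$, the warped product $B\times_f F$ is the manifold $M=B\times F$ with the metric $g=\pi^*g_B+(f\circ\pi)^2\sigma^*g_F$, where $\pi:B\times F\to B$ and $\sigma:B\times F\to F$ are the projections; $B$ is the base, $F$ the fiber and $f$ the warping function. A gradient Ricci soliton $(M,g,\nabla\psi,\lambda)$ is a complete Riemannian manifold $(M,g)$ with a smooth function $\psi$ on $M$ and a constant $\lambda\in\mathbb{R}$ such that $Ric+\nabla^2\psi=\lambda g$, where $\nabla^2\psi$ is the Hessian of $\psi$. A gradient Ricci soliton warped product is a gradient Ricci soliton $(M,g,\nabla\tilde\varphi,\lambda)$ where $M=B^n\times_f F^m$ is a warped product with metric $g$ and the potential function $\tilde\varphi=\varphi\circ\pi$ is the lift of a smooth function $\varphi$ on $B$. *)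

theory Defs
  imports "HOL-Analysis.Analysis"
begin

section \<open>Smooth maps between open sets of Euclidean spaces\<close>

text \<open>Meaningful on open sets, the only place where it is used.\<close>

primrec Ck_on :: "nat \<Rightarrow> ('a::euclidean_space \<Rightarrow> 'b::real_normed_vector) \<Rightarrow> 'a set \<Rightarrow> bool" where
  "Ck_on 0 h S \<longleftrightarrow> continuous_on S h"
| "Ck_on (Suc k) h S \<longleftrightarrow>
     (\<forall>y\<in>S. h differentiable (at y)) \<and> (\<forall>v. Ck_on k (\<lambda>y. frechet_derivative h (at y) v) S)"

definition smooth_on :: "('a::euclidean_space \<Rightarrow> 'b::real_normed_vector) \<Rightarrow> 'a set \<Rightarrow> bool" where
  "smooth_on h S \<longleftrightarrow> (\<forall>k. Ck_on k h S)"


section \<open>Smooth manifolds\<close>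

text \<open>
  The underlying space of a manifold is a whole type \<open>'a\<close>, the model space a Euclidean space
  \<open>'e\<close>, so the dimension is \<open>DIM('e)\<close>, which is at least 1.  A chart \<open>(U, x)\<close> is a domain
  together with a coordinate map, whose values outside \<open>U\<close> are irrelevant.  The smooth
  structure is given by an atlas, not required to be maximal.
\<close>

type_synonym ('a, 'e) chart = "'a set \<times> ('a \<Rightarrow> 'e)"

definition chart_inv :: "('a, 'e) chart \<Rightarrow> 'e \<Rightarrow> 'a" where
  "chart_inv c = inv_into (fst c) (snd c)"

definition smooth_manifold ::
    "('a::{t2_space,second_countable_topology}, 'e::euclidean_space) chart set \<Rightarrow> bool" where
  "smooth_manifold A \<longleftrightarrow>
     connected (UNIV :: 'a set) \<and>
     (\<Union>c\<in>A. fst c) = UNIV \<and>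
     (\<forall>c\<in>A. open (fst c) \<and> open (snd c ` fst c) \<and>
             homeomorphism (fst c) (snd c ` fst c) (snd c) (chart_inv c)) \<and>
     (\<forall>c\<in>A. \<forall>d\<in>A. smooth_on (snd d \<circ> chart_inv c) (snd c ` (fst c \<inter> fst d)))"

definition smooth_function :: "('a, 'e::euclidean_space) chart set \<Rightarrow> ('a \<Rightarrow> real) \<Rightarrow> bool" where
  "smooth_function A h \<longleftrightarrow> (\<forall>c\<in>A. smooth_on (h \<circ> chart_inv c) (snd c ` fst c))"

definition prod_atlas ::
    "('a, 'e) chart set \<Rightarrow> ('b, 'f) chart set \<Rightarrow> ('a \<times> 'b, 'e \<times> 'f) chart set" where
  "prod_atlas A B = {(fst c \<times> fst d, map_prod (snd c) (snd d)) | c d. c \<in> A \<and> d \<in> B}"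


section \<open>Riemannian metrics\<close>

text \<open>
  A covariant 2-tensor field \<open>g\<close> is given by its expression in each chart: \<open>g c p u v\<close> is its
  value at \<open>p\<close> on the two tangent vectors having the components \<open>u\<close> and \<open>v\<close> in the coordinate
  frame of \<open>c\<close>.  The first clause of \<open>riemannian_metric\<close> is the transformation rule between
  charts.
\<close>

type_synonym ('a, 'e) tensor2 = "('a, 'e) chart \<Rightarrow> 'a \<Rightarrow> 'e \<Rightarrow> 'e \<Rightarrow> real"

definition riemannian_metric ::
    "('a, 'e::euclidean_space) chart set \<Rightarrow> ('a, 'e) tensor2 \<Rightarrow> bool" where
  "riemannian_metric A g \<longleftrightarrow>
     (\<forall>c\<in>A. \<forall>d\<in>A. \<forall>p\<in>fst c \<inter> fst d. \<forall>u v.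
        g c p u v = (let L = frechet_derivative (snd d \<circ> chart_inv c) (at (snd c p))
                     in g d p (L u) (L v))) \<and>
     (\<forall>c\<in>A. \<forall>u v. smooth_on (\<lambda>y. g c (chart_inv c y) u v) (snd c ` fst c)) \<and>
     (\<forall>c\<in>A. \<forall>p\<in>fst c. bilinear (g c p) \<and> (\<forall>u v. g c p u v = g c p v u) \<and>
        (\<forall>u. u \<noteq> 0 \<longrightarrow> g c p u u > 0))"

definition riemannian_manifold ::
    "('a::{t2_space,second_countable_topology}, 'e::euclidean_space) chart set \<Rightarrow>
     ('a, 'e) tensor2 \<Rightarrow> bool" where
  "riemannian_manifold A g \<longleftrightarrow> smooth_manifold A \<and> riemannian_metric A g"

text \<open>
  Pullback along a smooth map \<open>F\<close> into the manifold with atlas \<open>A\<close>.  For a tensor field obeying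
  the transformation rule the choice of the chart around \<open>F p\<close> is immaterial.
\<close>

definition pullback ::
    "('b, 'f::euclidean_space) chart set \<Rightarrow> ('a \<Rightarrow> 'b) \<Rightarrow> ('b, 'f) tensor2 \<Rightarrow>
     ('a, 'e::euclidean_space) tensor2" where
  "pullback A F h c p u v =
     (let d = (SOME d. d \<in> A \<and> F p \<in> fst d);
          L = frechet_derivative (snd d \<circ> F \<circ> chart_inv c) (at (snd c p))
      in h d (F p) (L u) (L v))"

definition warped_metric ::
    "('a, 'e::euclidean_space) chart set \<Rightarrow> ('a, 'e) tensor2 \<Rightarrow> ('a \<Rightarrow> real) \<Rightarrow>
     ('b, 'f::euclidean_space) chart set \<Rightarrow> ('b, 'f) tensor2 \<Rightarrow>
     ('a \<times> 'b, 'e \<times> 'f) tensor2" where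
  "warped_metric AB gB f AF gF = (\<lambda>c p u v.
     pullback AB fst gB c p u v + ((f \<circ> fst) p)\<^sup>2 * pullback AF snd gF c p u v)"


section \<open>Levi-Civita connection, curvature, Hessian\<close>

text \<open>
  The following operators act on the coordinate expression \<open>G y u v\<close> of a metric, \<open>y\<close> being
  the coordinates of the point.  Constant vectors \<open>u, v, \<dots>\<close> stand for the coordinate vector
  fields with these constant components; such fields commute.
\<close>

definition sharp :: "('e \<Rightarrow> 'e \<Rightarrow> real) \<Rightarrow> ('e \<Rightarrow> real) \<Rightarrow> 'e" where
  "sharp b \<alpha> = (THE w. \<forall>z. b w z = \<alpha> z)"

definition trace :: "('e::euclidean_space \<Rightarrow> 'e) \<Rightarrow> real" where
  "trace L = (\<Sum>i\<in>Basis. L i \<bullet> i)"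

definition ddir :: "('e::euclidean_space \<Rightarrow> 'b::real_normed_vector) \<Rightarrow> 'e \<Rightarrow> 'e \<Rightarrow> 'b" where
  "ddir h y u = frechet_derivative h (at y) u"

text \<open>The vector \<open>\<nabla>\<^sub>u v\<close>, by the Koszul formula; its components are \<open>\<Gamma>\<^sup>k\<^sub>i\<^sub>j u\<^sup>i v\<^sup>j\<close>.\<close>

definition christoffel :: "('e::euclidean_space \<Rightarrow> 'e \<Rightarrow> 'e \<Rightarrow> real) \<Rightarrow> 'e \<Rightarrow> 'e \<Rightarrow> 'e \<Rightarrow> 'e" where
  "christoffel G y u v = sharp (G y) (\<lambda>z.
     (ddir (\<lambda>y. G y v z) y u + ddir (\<lambda>y. G y u z) y v - ddir (\<lambda>y. G y u v) y z) / 2)"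

text \<open>\<open>R(w, u) v = \<nabla>\<^sub>w \<nabla>\<^sub>u v - \<nabla>\<^sub>u \<nabla>\<^sub>w v\<close>\<close>

definition local_riemann ::
    "('e::euclidean_space \<Rightarrow> 'e \<Rightarrow> 'e \<Rightarrow> real) \<Rightarrow> 'e \<Rightarrow> 'e \<Rightarrow> 'e \<Rightarrow> 'e \<Rightarrow> 'e" where
  "local_riemann G y w u v =
     ddir (\<lambda>y. christoffel G y u v) y w + christoffel G y w (christoffel G y u v)
     - ddir (\<lambda>y. christoffel G y w v) y u - christoffel G y u (christoffel G y w v)"

definition in_chart :: "('a, 'e) tensor2 \<Rightarrow> ('a, 'e) chart \<Rightarrow> 'e \<Rightarrow> 'e \<Rightarrow> 'e \<Rightarrow> real" where
  "in_chart g c y = g c (chart_inv c y)"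

definition ricci :: "('a, 'e::euclidean_space) tensor2 \<Rightarrow> ('a, 'e) tensor2" where
  "ricci g c p u v = trace (\<lambda>w. local_riemann (in_chart g c) (snd c p) w u v)"

text \<open>The metric trace of the Ricci tensor, computed in the chart \<open>c\<close>.\<close>

definition scalar_curvature ::
    "('a, 'e::euclidean_space) tensor2 \<Rightarrow> ('a, 'e) chart \<Rightarrow> 'a \<Rightarrow> real" where
  "scalar_curvature g c p = trace (\<lambda>u. sharp (g c p) (ricci g c p u))"

definition hessian ::
    "('a, 'e::euclidean_space) tensor2 \<Rightarrow> ('a \<Rightarrow> real) \<Rightarrow> ('a, 'e) tensor2" where
  "hessian g \<psi> c p u v =
     (let h = \<psi> \<circ> chart_inv c; y = snd c p
      in ddir (\<lambda>y. ddir h y v) y u - ddir h y (christoffel (in_chart g c) y u v))"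


section \<open>Completeness\<close>

text \<open>
  Geodesic completeness: every initial velocity is that of a geodesic defined on the whole real
  line.  On connected manifolds this is metric completeness, by Hopf-Rinow.
\<close>

definition geodesic ::
    "('a::topological_space, 'e::euclidean_space) chart set \<Rightarrow> ('a, 'e) tensor2 \<Rightarrow>
     (real \<Rightarrow> 'a) \<Rightarrow> bool" where
  "geodesic A g \<gamma> \<longleftrightarrow> continuous_on UNIV \<gamma> \<and>
     (\<forall>c\<in>A. \<forall>t. \<gamma> t \<in> fst c \<longrightarrow>
        (let x = snd c \<circ> \<gamma>; x' = (\<lambda>s. vector_derivative x (at s))
         in x differentiable (at t) \<and>
            (x' has_vector_derivative - christoffel (in_chart g c) (x t) (x' t) (x' t)) (at t)))"

definition complete_metric ::
    "('a::topological_space, 'e::euclidean_space) chart set \<Rightarrow> ('a, 'e) tensor2 \<Rightarrow> bool" where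
  "complete_metric A g \<longleftrightarrow>
     (\<forall>c\<in>A. \<forall>p\<in>fst c. \<forall>v. \<exists>\<gamma>. geodesic A g \<gamma> \<and> \<gamma> 0 = p \<and>
        ((snd c \<circ> \<gamma>) has_vector_derivative v) (at 0))"


section \<open>Gradient Ricci solitons\<close>

definition gradient_ricci_soliton ::
    "('a::{t2_space,second_countable_topology}, 'e::euclidean_space) chart set \<Rightarrow>
     ('a, 'e) tensor2 \<Rightarrow> ('a \<Rightarrow> real) \<Rightarrow> real \<Rightarrow> bool" where
  "gradient_ricci_soliton A g \<psi> lam \<longleftrightarrow>
     riemannian_manifold A g \<and> complete_metric A g \<and> smooth_function A \<psi> \<and>
     (\<forall>c\<in>A. \<forall>p\<in>fst c. \<forall>u v. ricci g c p u v + hessian g \<psi> c p u v = lam * g c p u v)"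

definition gradient_ricci_soliton_warped_product ::
    "('a::{t2_space,second_countable_topology}, 'n::euclidean_space) chart set \<Rightarrow>
     ('a, 'n) tensor2 \<Rightarrow> ('a \<Rightarrow> real) \<Rightarrow>
     ('b::{t2_space,second_countable_topology}, 'm::euclidean_space) chart set \<Rightarrow>
     ('b, 'm) tensor2 \<Rightarrow> ('a \<Rightarrow> real) \<Rightarrow> real \<Rightarrow> bool" where
  "gradient_ricci_soliton_warped_product AB gB f AF gF \<phi> lam \<longleftrightarrow>
     riemannian_manifold AB gB \<and> riemannian_manifold AF gF \<and>
     smooth_function AB f \<and> (\<forall>p. f p > 0) \<and> smooth_function AB \<phi> \<and>
     gradient_ricci_soliton (prod_atlas AB AF) (warped_metric AB gB f AF gF) (\<phi> \<circ> fst) lam"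

end

theory Submission
  imports Defs
begin

text \<open>
  For vertical vectors \<open>u, v\<close> at \<open>(p, q)\<close> the soliton equation of the warped product reads
  \<open>Ric\<^sub>F(u, v) = \<mu> g\<^sub>F(u, v)\<close> with
  \<open>\<mu> = f \<Delta>f + (m - 1) \<bar>\<nabla>f\<bar>\<^sup>2 - f \<langle>\<nabla>\<phi>, \<nabla>f\<rangle> + \<lambda> f\<^sup>2\<close> evaluated at \<open>p\<close>.  Hence \<open>m \<mu>\<close> is the scalar
  curvature of the fiber at \<open>q\<close>, so that \<open>\<mu>\<close> is a non-positive constant.  At a maximum and at a
  minimum of \<open>f\<close> the equation gives \<open>\<lambda> f\<^sub>m\<^sub>i\<^sub>n\<^sup>2 \<le> \<mu> \<le> \<lambda> f\<^sub>m\<^sub>a\<^sub>x\<^sup>2\<close>; as \<open>\<mu> \<le> 0\<close> and \<open>f\<close> is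
  not constant, this forces \<open>\<lambda> = \<mu> = 0\<close>.  Then \<open>f\<close> satisfies the linear elliptic equation
  \<open>\<Delta>f + \<langle>X, \<nabla>f\<rangle> = 0\<close> with the continuous field \<open>X = ((m - 1) / f) \<nabla>f - \<nabla>\<phi>\<close>, and Hopf's strong
  maximum principle makes \<open>f\<close> constant.
\<close>

section \<open>Inner products and orthonormal frames\<close>

text \<open>The argument separates variables: the scalar curvature at \<open>q\<close> sees only the
  fiber, \<open>\<mu>\<close> only the base, so fixing one fiber point leaves a single scalar
  equation on the whole base. Two features shape the rest. Connection and gradient are defined
  through \<open>sharp\<close>, a definite description, so even their differentiability must be
  derived. And second-order operators are written as sums over a frame orthonormal for the metric at
  one point, chosen anew at each point with no regularity; hence the maximum principle is stated for
  coefficients that are merely bounded and uniformly elliptic. It is needed because for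
  \<open>\<lambda> = \<mu> = 0\<close> the inequalities at the two extrema become trivial. It is
  local; connectedness of the base makes it global.\<close>

definition posdef :: "('e::euclidean_space \<Rightarrow> 'e \<Rightarrow> real) \<Rightarrow> bool" where
  "posdef b \<longleftrightarrow> bilinear b \<and> (\<forall>u v. b u v = b v u) \<and> (\<forall>u. u \<noteq> 0 \<longrightarrow> b u u > 0)"

lemma posdefD:
  assumes "posdef b"
  shows "bilinear b" "b u v = b v u" "u \<noteq> 0 \<Longrightarrow> b u u > 0" "linear (b u)" "linear (\<lambda>u. b u v)"
  using assms by (auto simp: posdef_def bilinear_def)

lemma posdef_nondegenerate:
  assumes "posdef b" "\<And>z. b w z = b w' z"
  shows "w = w'"
proof (rule ccontr)
  assume "w \<noteq> w'"
  then have "b (w - w') (w - w') > 0" using posdefD(3)[OF assms(1), of "w - w'"] by simp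
  then show False using assms(2) by (simp add: bilinear_lsub[OF posdefD(1)[OF assms(1)]])
qed

lemma sharp_eqI:
  assumes "posdef b" "\<And>z. b w z = \<alpha> z"
  shows "sharp b \<alpha> = w"
  unfolding sharp_def
  by (rule the_equality) (use assms posdef_nondegenerate[OF assms(1)] in auto)

lemma linear_euclidean_sum:
  fixes T :: "'a::euclidean_space \<Rightarrow> 'b::real_vector"
  assumes "linear T"
  shows "T x = (\<Sum>i\<in>Basis. (x \<bullet> i) *\<^sub>R T i)"
proof -
  have "T x = T (\<Sum>i\<in>Basis. (x \<bullet> i) *\<^sub>R i)" by (simp add: euclidean_representation)
  also have "\<dots> = (\<Sum>i\<in>Basis. (x \<bullet> i) *\<^sub>R T i)"
    by (simp add: linear_sum[OF assms] linear_cmul[OF assms])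
  finally show ?thesis .
qed

lemma bilinear_euclidean_sum:
  fixes b :: "'a::euclidean_space \<Rightarrow> 'b::euclidean_space \<Rightarrow> 'c::real_vector"
  assumes "bilinear b"
  shows "b x y = (\<Sum>i\<in>Basis. \<Sum>j\<in>Basis. ((x \<bullet> i) * (y \<bullet> j)) *\<^sub>R b i j)"
proof -
  have "b x y = (\<Sum>i\<in>Basis. (x \<bullet> i) *\<^sub>R b i y)"
    using linear_euclidean_sum[of "\<lambda>x. b x y" x] assms by (simp add: bilinear_def)
  also have "\<dots> = (\<Sum>i\<in>Basis. (x \<bullet> i) *\<^sub>R (\<Sum>j\<in>Basis. (y \<bullet> j) *\<^sub>R b i j))"
    using linear_euclidean_sum[of "b i" y for i] assms by (simp add: bilinear_def)
  finally show ?thesis by (simp add: scaleR_sum_right)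
qed

lemma bilinear_bound:
  fixes b :: "'a::euclidean_space \<Rightarrow> 'b::euclidean_space \<Rightarrow> 'c::real_normed_vector"
  assumes "bilinear b"
  shows "norm (b x y) \<le> (\<Sum>i\<in>Basis. \<Sum>j\<in>Basis. norm (b i j)) * (norm x * norm y)"
proof -
  have "norm (b x y) \<le> (\<Sum>i\<in>Basis. \<Sum>j\<in>Basis. norm (((x \<bullet> i) * (y \<bullet> j)) *\<^sub>R b i j))"
    unfolding bilinear_euclidean_sum[OF assms, of x y]
    by (intro order_trans[OF norm_sum] sum_mono) auto
  also have "\<dots> \<le> (\<Sum>i\<in>Basis. \<Sum>j\<in>Basis. norm (b i j) * (norm x * norm y))"
    by (intro sum_mono)
       (auto simp: abs_mult mult.commute[of "norm (b _ _)"] intro!: mult_mono Basis_le_norm)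
  finally show ?thesis by (simp add: sum_distrib_right)
qed

text \<open>The Euclidean inner product represents \<open>b w\<close> by a vector
  \<open>A w\<close>; \<open>A\<close> is injective as \<open>b\<close> is nondegenerate, hence
  surjective in finite dimension. This is the existence half of the definite description in
  \<open>sharp\<close>.\<close>

lemma sharp_works:
  assumes b: "posdef b" and a: "linear \<alpha>"
  shows "b (sharp b \<alpha>) z = \<alpha> z"
proof -
  define A where "A w = (\<Sum>i\<in>Basis. b w i *\<^sub>R i)" for w
  have lb: "\<And>z. linear (\<lambda>w. b w z)" using posdefD[OF b] by blast
  have A: "A w \<bullet> z = b w z" for w z
    using linear_euclidean_sum[OF posdefD(4)[OF b], of w z]
    by (simp add: A_def inner_sum_left inner_commute[of z] mult.commute)
  have "linear A"
    by (rule linearI; rule euclidean_eqI)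
       (auto simp: A inner_add_left linear_add[OF lb] linear_cmul[OF lb])
  moreover have "inj A"
  proof (rule injI)
    fix w w' assume "A w = A w'"
    then show "w = w'" using A by (intro posdef_nondegenerate[OF b]) metis
  qed
  ultimately have "surj A" by (rule linear_injective_imp_surjective[OF _ _ refl])
  then obtain w where w: "A w = (\<Sum>i\<in>Basis. \<alpha> i *\<^sub>R i)" by (metis surjD)
  have "b w z = \<alpha> z" for z
  proof -
    have "b w z = (\<Sum>i\<in>Basis. \<alpha> i * (i \<bullet> z))" using A[of w z] by (simp add: w inner_sum_left)
    then show ?thesis using linear_euclidean_sum[OF a, of z] by (simp add: inner_commute[of z] mult.commute)
  qed
  then show ?thesis using sharp_eqI[OF b] by metis
qed

definition orthonormal_frame :: "('e::euclidean_space \<Rightarrow> 'e \<Rightarrow> real) \<Rightarrow> 'e set \<Rightarrow> bool" where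
  "orthonormal_frame b E \<longleftrightarrow> finite E \<and> card E \<le> DIM('e) \<and> (\<forall>e\<in>E. b e e = 1) \<and>
     (\<forall>e\<in>E. \<forall>e'\<in>E. e \<noteq> e' \<longrightarrow> b e e' = 0) \<and> (\<forall>x. x = (\<Sum>e\<in>E. b x e *\<^sub>R e))"

text \<open>An orthonormal set of greatest cardinality works: such sets are independent, so their
  size is bounded, and a vector not recovered by its expansion leaves a remainder that would enlarge
  the set.\<close>

lemma orthonormal_frame_exists:
  fixes b :: "'e::euclidean_space \<Rightarrow> 'e \<Rightarrow> real"
  assumes b: "posdef b"
  shows "\<exists>E. orthonormal_frame b E"
proof -
  define ON where "ON E \<longleftrightarrow> finite E \<and> (\<forall>e\<in>E. b e e = 1) \<and>
     (\<forall>e\<in>E. \<forall>e'\<in>E. e \<noteq> e' \<longrightarrow> b e e' = 0)" for E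
  note bl = posdefD(1)[OF b]
  have sum: "b (\<Sum>e\<in>E. r e *\<^sub>R e) e' = r e'" if "ON E" "e' \<in> E" for E r e'
  proof -
    have "b (\<Sum>e\<in>E. r e *\<^sub>R e) e' = (\<Sum>e\<in>E. r e * b e e')"
      by (simp add: linear_sum[OF posdefD(5)[OF b]] linear_cmul[OF posdefD(5)[OF b]])
    also have "\<dots> = (\<Sum>e\<in>E. if e = e' then r e else 0)"
      by (rule sum.cong) (use that in \<open>auto simp: ON_def\<close>)
    finally show ?thesis using that by (auto simp: ON_def)
  qed
  have card: "card E \<le> DIM('e)" if "ON E" for E
  proof -
    have "independent E"
    proof
      assume dep: "dependent E"
      have "finite E" using that by (simp add: ON_def)
      from dep[unfolded dependent_finite[OF this]]
      obtain r e' where "e' \<in> E" "r e' \<noteq> 0" "(\<Sum>e\<in>E. r e *\<^sub>R e) = 0" by auto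
      then show False using sum[OF that, of e' r] bilinear_lzero[OF bl] by simp
    qed
    then show ?thesis using independent_bound by blast
  qed
  have "ON {}" by (simp add: ON_def)
  then have "\<exists>E. ON E \<and> (\<forall>E'. ON E' \<longrightarrow> card E' \<le> card E)"
    using card by (intro ex_has_greatest_nat[of ON "{}" card "Suc DIM('e)"]) (auto simp: less_Suc_eq_le)
  then obtain E where E: "ON E" and max: "\<And>E'. ON E' \<Longrightarrow> card E' \<le> card E" by blast
  have "x = (\<Sum>e\<in>E. b x e *\<^sub>R e)" for x
  proof (rule ccontr)
    define d where "d = x - (\<Sum>e\<in>E. b x e *\<^sub>R e)"
    define d' where "d' = (1 / sqrt (b d d)) *\<^sub>R d"
    assume "x \<noteq> (\<Sum>e\<in>E. b x e *\<^sub>R e)"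
    then have "d \<noteq> 0" by (simp add: d_def)
    then have pos: "b d d > 0" by (rule posdefD(3)[OF b])
    have d: "b d e = 0" if "e \<in> E" for e
      by (simp add: d_def bilinear_lsub[OF bl] sum[OF E that])
    have d': "b d' e = 0" "b e d' = 0" if "e \<in> E" for e
      using d[OF that] posdefD(2)[OF b, of e d] by (auto simp: d'_def bilinear_lmul[OF bl] bilinear_rmul[OF bl])
    have d'1: "b d' d' = 1"
      using pos by (simp add: d'_def bilinear_lmul[OF bl] bilinear_rmul[OF bl] field_simps)
    have "ON (insert d' E)" using E d' d'1 by (auto simp: ON_def)
    moreover have "d' \<notin> E" using d' d'1 by force
    ultimately show False using max[of "insert d' E"] E by (auto simp: ON_def)
  qed
  then show ?thesis using E card[OF E] unfolding orthonormal_frame_def ON_def by blast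
qed

text \<open>Each basis vector is expanded in the frame; then the sum over \<open>Basis\<close> is
  folded back into \<open>b (T e) e\<close> by linearity in the first argument.\<close>

lemma trace_orthonormal_frame:
  assumes b: "posdef b" and E: "orthonormal_frame b E" and T: "linear T"
  shows "trace T = (\<Sum>e\<in>E. b (T e) e)"
proof -
  have ex: "x = (\<Sum>e\<in>E. b x e *\<^sub>R e)" for x using E by (auto simp: orthonormal_frame_def)
  have Ti: "T i = (\<Sum>e\<in>E. b i e *\<^sub>R T e)" for i
    by (subst ex) (simp add: linear_sum[OF T] linear_cmul[OF T])
  have "trace T = (\<Sum>i\<in>Basis. \<Sum>e\<in>E. b i e * (T e \<bullet> i))"
    unfolding trace_def by (subst Ti) (simp add: inner_sum_left)
  also have "\<dots> = (\<Sum>e\<in>E. \<Sum>i\<in>Basis. (T e \<bullet> i) * b i e)"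
    by (subst sum.swap) (simp add: mult.commute)
  also have "\<dots> = (\<Sum>e\<in>E. b (T e) e)"
    using linear_euclidean_sum[OF posdefD(5)[OF b], of "T _"] by simp
  finally show ?thesis .
qed

text \<open>From \<open>b e e = 1\<close> and coercivity each \<open>e\<close> has squared norm at
  most \<open>1 / k\<close>. The sum is the Euclidean trace of the second-order coefficient matrix
  in the maximum principle.\<close>

lemma orthonormal_frame_norm_bound:
  fixes b :: "'e::euclidean_space \<Rightarrow> 'e \<Rightarrow> real"
  assumes E: "orthonormal_frame b E" and k: "k > 0" "\<And>w. k * (norm w)\<^sup>2 \<le> b w w"
  shows "(\<Sum>e\<in>E. (norm e)\<^sup>2) \<le> real DIM('e) / k"
proof -
  have "(norm e)\<^sup>2 \<le> 1 / k" if "e \<in> E" for e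
    using k(1) k(2)[of e] E that by (simp add: orthonormal_frame_def field_simps)
  then have "(\<Sum>e\<in>E. (norm e)\<^sup>2) \<le> real (card E) * (1 / k)"
    by (rule sum_bounded_above)
  also have "\<dots> \<le> real DIM('e) * (1 / k)"
  proof (intro mult_right_mono)
    have "card E \<le> DIM('e)" using E unfolding orthonormal_frame_def by blast
    then show "real (card E) \<le> real DIM('e)" by simp
  qed (use k(1) in simp)
  finally show ?thesis by simp
qed

text \<open>The sum is the inverse metric on the covector \<open>\<xi>\<close>, the principal symbol
  of the Laplacian, so an upper bound \<open>K\<close> of the metric becomes the lower bound
  \<open>1 / K\<close>. The proof is Cauchy-Schwarz on
  \<open>\<Sum>e. b \<xi> e * (\<xi> \<bullet> e)\<close>.\<close>

lemma orthonormal_frame_coercive: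
  fixes b :: "'e::euclidean_space \<Rightarrow> 'e \<Rightarrow> real"
  assumes b: "posdef b" and E: "orthonormal_frame b E" and K: "K > 0" "\<And>w. b w w \<le> K * (norm w)\<^sup>2"
  shows "(1 / K) * (norm \<xi>)\<^sup>2 \<le> (\<Sum>e\<in>E. (\<xi> \<bullet> e)\<^sup>2)"
proof (cases "\<xi> = 0")
  case False
  have ex: "\<xi> = (\<Sum>e\<in>E. b \<xi> e *\<^sub>R e)" using E unfolding orthonormal_frame_def by blast
  have "\<xi> \<bullet> \<xi> = \<xi> \<bullet> (\<Sum>e\<in>E. b \<xi> e *\<^sub>R e)" using ex by simp
  then have 1: "(norm \<xi>)\<^sup>2 = (\<Sum>e\<in>E. b \<xi> e * (\<xi> \<bullet> e))"
    by (simp add: inner_sum_right dot_square_norm)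
  have "b \<xi> \<xi> = b \<xi> (\<Sum>e\<in>E. b \<xi> e *\<^sub>R e)" using ex by simp
  then have 2: "b \<xi> \<xi> = (\<Sum>e\<in>E. (b \<xi> e)\<^sup>2)"
    by (simp add: linear_sum[OF posdefD(4)[OF b]] linear_cmul[OF posdefD(4)[OF b]] power2_eq_square)
  have "((norm \<xi>)\<^sup>2)\<^sup>2 \<le> b \<xi> \<xi> * (\<Sum>e\<in>E. (\<xi> \<bullet> e)\<^sup>2)"
    unfolding 1 2 by (rule Cauchy_Schwarz_ineq_sum)
  also have "\<dots> \<le> K * (norm \<xi>)\<^sup>2 * (\<Sum>e\<in>E. (\<xi> \<bullet> e)\<^sup>2)"
    by (intro mult_right_mono K sum_nonneg) auto
  finally have "(norm \<xi>)\<^sup>2 * (norm \<xi>)\<^sup>2 \<le> (norm \<xi>)\<^sup>2 * (K * (\<Sum>e\<in>E. (\<xi> \<bullet> e)\<^sup>2))"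
    by (simp add: power2_eq_square algebra_simps)
  then have "(norm \<xi>)\<^sup>2 \<le> K * (\<Sum>e\<in>E. (\<xi> \<bullet> e)\<^sup>2)"
    using False by (subst (asm) mult_le_cancel_left_pos) auto
  then show ?thesis using K(1) by (simp add: field_simps)
qed (simp add: sum_nonneg)

lemma trace_prod:
  fixes L :: "'n::euclidean_space \<times> 'm::euclidean_space \<Rightarrow> 'n \<times> 'm"
  shows "trace L = trace (\<lambda>w. fst (L (w, 0))) + trace (\<lambda>w. snd (L (0, w)))"
proof -
  have disj: "(\<lambda>i::'n. (i, 0::'m)) ` Basis \<inter> (\<lambda>j::'m. (0::'n, j)) ` Basis = {}"
    using nonzero_Basis by auto
  show ?thesis
    unfolding trace_def Basis_prod_def
    by (subst sum.union_disjoint[OF _ _ disj]) (auto simp: sum.reindex inj_on_def inner_prod_def)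
qed

lemma posdef_coercive:
  fixes b :: "'e::euclidean_space \<Rightarrow> 'e \<Rightarrow> real"
  assumes b: "posdef b"
  shows "\<exists>k>0. \<forall>w. k * (norm w)\<^sup>2 \<le> b w w"
proof -
  note bl = posdefD(1)[OF b]
  have "bounded_bilinear b" using bl by (simp add: bilinear_conv_bounded_bilinear)
  then have cont: "continuous_on (sphere 0 1) (\<lambda>w. b w w)"
    using bounded_bilinear.continuous_on continuous_on_id by blast
  have ne: "sphere (0::'e) 1 \<noteq> {}" by simp
  obtain x where x: "x \<in> sphere 0 1" and min: "\<And>w. w \<in> sphere 0 1 \<Longrightarrow> b x x \<le> b w w"
    using continuous_attains_inf[OF compact_sphere ne cont] by auto
  have "b x x * (norm w)\<^sup>2 \<le> b w w" for w
  proof (cases "w = 0")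
    case True
    then show ?thesis by (simp add: bilinear_lzero[OF bl])
  next
    case False
    have "b x x \<le> b ((1 / norm w) *\<^sub>R w) ((1 / norm w) *\<^sub>R w)" by (rule min) (use False in simp)
    also have "\<dots> = b w w / (norm w)\<^sup>2"
      by (simp add: bilinear_lmul[OF bl] bilinear_rmul[OF bl] power2_eq_square)
    finally show ?thesis using False by (simp add: field_simps)
  qed
  moreover have "b x x > 0" using x by (intro posdefD(3)[OF b]) auto
  ultimately show ?thesis by blast
qed

text \<open>Convergence of the finitely many entries controls the whole form. The perturbation costs
  half of the constant \<open>k\<close> at \<open>y0\<close>: hence \<open>k/2\<close> below and the
  summand \<open>k/2\<close> in \<open>K\<close> above.\<close>

lemma posdef_eventually_elliptic:
  fixes G :: "'a::topological_space \<Rightarrow> 'e::euclidean_space \<Rightarrow> 'e \<Rightarrow> real"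
  assumes pd: "eventually (\<lambda>y. posdef (G y)) (nhds y0)"
    and cont: "\<And>u v. ((\<lambda>y. G y u v) \<longlongrightarrow> G y0 u v) (nhds y0)"
  shows "\<exists>k>0. \<exists>K>0. eventually (\<lambda>y. \<forall>w. k * (norm w)\<^sup>2 \<le> G y w w \<and> G y w w \<le> K * (norm w)\<^sup>2) (nhds y0)"
proof -
  have b: "posdef (G y0)" using pd by (rule eventually_nhds_x_imp_x)
  obtain k where k: "k > 0" "\<And>w. k * (norm w)\<^sup>2 \<le> G y0 w w" using posdef_coercive[OF b] by blast
  define m where "m y = (\<Sum>i\<in>Basis. \<Sum>j\<in>Basis. norm (G y i j - G y0 i j))" for y
  define K where "K = (\<Sum>i\<in>Basis. \<Sum>j\<in>Basis. norm (G y0 i j)) + k/2"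
  have "((\<lambda>y. m y) \<longlongrightarrow> (\<Sum>i\<in>(Basis::'e set). \<Sum>j\<in>(Basis::'e set). norm (G y0 i j - G y0 i j))) (nhds y0)"
    unfolding m_def by (intro tendsto_intros cont)
  then have "(m \<longlongrightarrow> 0) (nhds y0)" by simp
  then have "eventually (\<lambda>y. m y < k/2) (nhds y0)" using k by (intro order_tendstoD(2)) auto
  with pd have "eventually (\<lambda>y. \<forall>w. (k/2) * (norm w)\<^sup>2 \<le> G y w w \<and> G y w w \<le> K * (norm w)\<^sup>2) (nhds y0)"
  proof eventually_elim
    case (elim y)
    show ?case
    proof
      fix w
      have bil: "bilinear (\<lambda>u v. G y u v - G y0 u v)"
        using posdefD(4,5)[OF b] posdefD(4,5)[OF elim(1)]
        by (auto simp: bilinear_def intro: linear_compose_sub)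
      have 1: "\<bar>G y w w - G y0 w w\<bar> \<le> m y * (norm w)\<^sup>2"
        using bilinear_bound[OF bil, of w w] by (simp add: m_def power2_eq_square)
      have 2: "m y * (norm w)\<^sup>2 \<le> k/2 * (norm w)\<^sup>2"
        using elim(2) by (intro mult_right_mono) auto
      have 3: "G y0 w w \<le> (\<Sum>i\<in>Basis. \<Sum>j\<in>Basis. norm (G y0 i j)) * (norm w)\<^sup>2"
        using bilinear_bound[OF posdefD(1)[OF b], of w w] by (simp add: power2_eq_square)
      show "(k/2) * (norm w)\<^sup>2 \<le> G y w w \<and> G y w w \<le> K * (norm w)\<^sup>2"
        using 1 2 3 k(2)[of w] by (auto simp: K_def algebra_simps)
    qed
  qed
  moreover have "K > 0" using k(1) by (auto simp: K_def intro!: add_nonneg_pos sum_nonneg)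
  ultimately show ?thesis using k(1) by (intro exI[of _ "k/2"] exI[of _ K]) auto
qed

section \<open>Directional derivatives\<close>

lemma ddir_eq_frechet_derivative: "ddir h y = frechet_derivative h (at y)"
  by (simp add: ddir_def fun_eq_iff)

lemma smooth_on_ddir:
  assumes "smooth_on h S"
  shows "smooth_on (\<lambda>y. ddir h y v) S"
  using assms unfolding smooth_on_def ddir_def by (metis Ck_on.simps(2))

lemma smooth_on_has_derivative:
  assumes "smooth_on h S" "y \<in> S"
  shows "(h has_derivative ddir h y) (at y)"
proof -
  have "Ck_on (Suc 0) h S" using assms(1) unfolding smooth_on_def by blast
  then have "h differentiable (at y)" using assms(2) by auto
  then show ?thesis unfolding ddir_eq_frechet_derivative by (simp add: frechet_derivative_works[symmetric])
qed

lemma smooth_on_differentiable: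
  "smooth_on h S \<Longrightarrow> y \<in> S \<Longrightarrow> h differentiable (at y)"
  using smooth_on_has_derivative differentiableI by blast

lemma linear_ddir: "h differentiable (at y) \<Longrightarrow> linear (ddir h y)"
  by (simp add: ddir_eq_frechet_derivative linear_frechet_derivative)

lemma ddir_eqI: "(h has_derivative h') (at y) \<Longrightarrow> ddir h y v = h' v"
  unfolding ddir_def using frechet_derivative_at by metis

lemma has_derivative_ddir: "h differentiable (at y) \<Longrightarrow> (h has_derivative ddir h y) (at y)"
  by (simp add: ddir_eq_frechet_derivative frechet_derivative_works[symmetric])

lemma ddir_cong_open:
  assumes "open S" "y \<in> S" "\<And>x. x \<in> S \<Longrightarrow> h x = h' x"
  shows "ddir h y v = ddir h' y v"
proof -
  have "(h has_derivative D) (at y) \<longleftrightarrow> (h' has_derivative D) (at y)" for D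
    using has_derivative_transform_within_open[OF _ assms(1,2), of h D UNIV h']
      has_derivative_transform_within_open[OF _ assms(1,2), of h' D UNIV h] assms(3) by auto
  then show ?thesis by (simp add: ddir_def frechet_derivative_def)
qed

lemma differentiable_cong_open:
  assumes "h differentiable (at y)" "open S" "y \<in> S" "\<And>x. x \<in> S \<Longrightarrow> h x = h' x"
  shows "h' differentiable (at y)"
  using assms has_derivative_transform_within_open unfolding differentiable_def by metis

lemma has_derivative_fst_comp:
  "(h has_derivative h') (at y) \<Longrightarrow> ((\<lambda>p. h (fst p)) has_derivative (\<lambda>w. h' (fst w))) (at (y, z))"
  using has_derivative_compose[OF has_derivative_fst[OF has_derivative_ident], of h h' "(y, z)"] by simp

lemma has_derivative_snd_comp:
  "(h has_derivative h') (at z) \<Longrightarrow> ((\<lambda>p. h (snd p)) has_derivative (\<lambda>w. h' (snd w))) (at (y, z))"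
  using has_derivative_compose[OF has_derivative_snd[OF has_derivative_ident], of h h' "(y, z)"] by simp

text \<open>O(|x - y|) times o(1) is o(|x - y|), even if neither factor is differentiable. This is
  the error term in \<open>sharp_differentiable\<close>.\<close>

lemma has_derivative_zero_mult:
  fixes h k :: "'a::real_normed_vector \<Rightarrow> real"
  assumes h: "eventually (\<lambda>x. \<bar>h x\<bar> \<le> C * norm (x - y)) (nhds y)"
    and k: "(k \<longlongrightarrow> 0) (nhds y)"
  shows "((\<lambda>x. h x * k x) has_derivative (\<lambda>_. 0)) (at y)"
proof -
  have h0: "h y = 0" using eventually_nhds_x_imp_x[OF h] by simp
  have "((\<lambda>x. \<bar>C\<bar> * \<bar>k x\<bar>) \<longlongrightarrow> \<bar>C\<bar> * \<bar>0\<bar>) (at y)"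
    using k by (intro tendsto_intros) (auto simp: tendsto_nhds_iff)
  then have "((\<lambda>x. \<bar>C\<bar> * \<bar>k x\<bar>) \<longlongrightarrow> 0) (at y)" by simp
  moreover have "eventually (\<lambda>x. norm (h x * k x / norm (x - y)) \<le> \<bar>C\<bar> * \<bar>k x\<bar>) (at y)"
  proof -
    have "eventually (\<lambda>x. \<bar>h x\<bar> \<le> C * norm (x - y) \<and> x \<noteq> y) (at y)"
      using h by (auto simp: eventually_at_filter elim: eventually_mono)
    then show ?thesis
    proof eventually_elim
      case (elim x)
      then have "\<bar>h x\<bar> \<le> \<bar>C\<bar> * norm (x - y)"
        by (meson abs_ge_self mult_right_mono norm_ge_zero order_trans)
      then have "\<bar>h x\<bar> * \<bar>k x\<bar> \<le> \<bar>C\<bar> * norm (x - y) * \<bar>k x\<bar>" by (intro mult_right_mono) auto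
      then show ?case using elim by (simp add: abs_mult field_simps)
    qed
  qed
  ultimately have "((\<lambda>x. h x * k x / norm (x - y)) \<longlongrightarrow> 0) (at y)"
    by (rule Lim_null_comparison[rotated])
  then show ?thesis
    by (auto simp: has_derivative_at_within h0 bounded_linear_zero divide_inverse mult.commute)
qed

text \<open>Two passes replace matrix inversion. The increment \<open>d\<close> solves
  \<open>G y (d y) = \<beta> y\<close> with \<open>\<beta> y0 = 0\<close>, and coercivity makes it
  O(|y - y0|). Then, with \<open>J\<close> inverting the fixed form \<open>b\<close>,
  \<open>d = J \<beta> - J ((G - b) d)\<close>: the first part is differentiable, the second is o(|y
  - y0|).\<close>

lemma sharp_differentiable:
  fixes G :: "'a::real_normed_vector \<Rightarrow> 'e::euclidean_space \<Rightarrow> 'e \<Rightarrow> real"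
  assumes S: "open S" "y0 \<in> S" and pd: "\<And>y. y \<in> S \<Longrightarrow> posdef (G y)"
    and dG: "\<And>u v. (\<lambda>y. G y u v) differentiable (at y0)"
    and la: "\<And>y. y \<in> S \<Longrightarrow> linear (\<alpha> y)" and da: "\<And>z. (\<lambda>y. \<alpha> y z) differentiable (at y0)"
  shows "(\<lambda>y. sharp (G y) (\<alpha> y)) differentiable (at y0)"
proof -
  define b where "b = G y0"
  have b: "posdef b" using pd S by (simp add: b_def)
  note bl = posdefD(1)[OF b]
  have evS: "eventually (\<lambda>y. y \<in> S) (nhds y0)" using S eventually_nhds by blast
  have cont: "((\<lambda>y. G y u v) \<longlongrightarrow> G y0 u v) (nhds y0)" for u v
    using differentiable_imp_continuous_within[OF dG] by (simp add: continuous_within tendsto_nhds_iff)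
  define w0 where "w0 = sharp b (\<alpha> y0)"
  define s where "s i = sharp b (\<lambda>z. i \<bullet> z)" for i
  define \<beta> where "\<beta> y z = \<alpha> y z - G y w0 z" for y z
  define d where "d y = sharp (G y) (\<alpha> y) - w0" for y
  have lin\<beta>: "linear (\<beta> y)" if "y \<in> S" for y
    using la[OF that] posdefD(4)[OF pd[OF that]] unfolding \<beta>_def by (rule linear_compose_sub)
  have d: "G y (d y) z = \<beta> y z" if "y \<in> S" for y z
    using sharp_works[OF pd[OF that] la[OF that]] bilinear_lsub[OF posdefD(1)[OF pd[OF that]]]
    by (simp add: d_def \<beta>_def)
  have d\<beta>: "(\<lambda>y. \<beta> y z) differentiable (at y0)" for z
    unfolding \<beta>_def using da dG by (intro differentiable_diff)
  have \<beta>0: "\<beta> y0 z = 0" for z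
    using sharp_works[OF b la[OF S(2)]] by (simp add: \<beta>_def w0_def b_def)
  obtain B where B: "\<And>i. eventually (\<lambda>y. \<bar>\<beta> y i\<bar> \<le> B i * norm (y - y0)) (nhds y0)"
  proof -
    have "\<exists>B. eventually (\<lambda>y. \<bar>\<beta> y i\<bar> \<le> B * norm (y - y0)) (nhds y0)" for i
    proof -
      obtain D where D: "((\<lambda>y. \<beta> y i) has_derivative D) (at y0)"
        using d\<beta> unfolding differentiable_def by blast
      obtain K where K: "\<And>x. norm (D x) \<le> norm x * K"
        using bounded_linear.pos_bounded[OF has_derivative_bounded_linear[OF D]] by blast
      obtain r where r: "r > 0" "\<And>y. norm (y - y0) < r \<Longrightarrow> norm (\<beta> y i - \<beta> y0 i - D (y - y0)) \<le> 1 * norm (y - y0)"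
        using D unfolding has_derivative_at_alt by (metis zero_less_one)
      have "eventually (\<lambda>y. y \<in> ball y0 r) (nhds y0)" using r by (intro eventually_nhds_in_open) auto
      then have "eventually (\<lambda>y. \<bar>\<beta> y i\<bar> \<le> (1 + K) * norm (y - y0)) (nhds y0)"
      proof eventually_elim
        case (elim y)
        then have "\<bar>\<beta> y i - D (y - y0)\<bar> \<le> norm (y - y0)"
          using r(2)[of y] \<beta>0 by (simp add: dist_norm norm_minus_commute)
        moreover have "\<bar>D (y - y0)\<bar> \<le> norm (y - y0) * K" using K[of "y - y0"] by simp
        ultimately show ?case by (simp add: algebra_simps)
      qed
      then show ?thesis by blast
    qed
    then show ?thesis using that by metis
  qed
  obtain k K where k: "k > 0"
    and ell: "eventually (\<lambda>y. \<forall>w. k * (norm w)\<^sup>2 \<le> G y w w \<and> G y w w \<le> K * (norm w)\<^sup>2) (nhds y0)"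
    using posdef_eventually_elliptic[OF eventually_mono[OF evS pd] cont] by blast
  \<comment> \<open>Testing the equation of \<open>d y\<close> with \<open>d y\<close> itself bounds
    \<open>k |d|^2\<close> by the sum of \<open>|d \<bullet> i| |\<beta> y i|\<close>, which yields
    this constant.\<close>
  define C where "C = (\<Sum>i\<in>Basis. B i) / k"
  have "eventually (\<lambda>y. \<forall>i\<in>Basis. \<bar>\<beta> y i\<bar> \<le> B i * norm (y - y0)) (nhds y0)"
    using B by (intro eventually_ball_finite) auto
  with evS ell have dC: "eventually (\<lambda>y. norm (d y) \<le> C * norm (y - y0)) (nhds y0)"
  proof eventually_elim
    case (elim y)
    have "k * (norm (d y))\<^sup>2 \<le> \<beta> y (d y)" using elim(2) d[OF elim(1)] by metis
    also have "\<dots> = (\<Sum>i\<in>Basis. (d y \<bullet> i) * \<beta> y i)"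
      using linear_euclidean_sum[OF lin\<beta>[OF elim(1)], of "d y"] by simp
    also have "\<dots> \<le> (\<Sum>i\<in>Basis. norm (d y) * (B i * norm (y - y0)))"
    proof (rule sum_mono)
      fix i :: 'e assume i: "i \<in> Basis"
      have "(d y \<bullet> i) * \<beta> y i \<le> \<bar>d y \<bullet> i\<bar> * \<bar>\<beta> y i\<bar>" by (metis abs_ge_self abs_mult)
      also have "\<dots> \<le> norm (d y) * (B i * norm (y - y0))"
        using i elim(3) by (intro mult_mono Basis_le_norm) auto
      finally show "(d y \<bullet> i) * \<beta> y i \<le> norm (d y) * (B i * norm (y - y0))" .
    qed
    also have "\<dots> = norm (d y) * (k * C * norm (y - y0))"
      using k by (simp add: C_def sum_distrib_left[symmetric] sum_distrib_right[symmetric])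
    finally have "norm (d y) * (k * norm (d y)) \<le> norm (d y) * (k * C * norm (y - y0))"
      by (simp add: power2_eq_square algebra_simps)
    then have "norm (d y) = 0 \<or> k * norm (d y) \<le> k * (C * norm (y - y0))"
      using mult_le_cancel_left_pos[of "norm (d y)"] by (cases "norm (d y) = 0") (simp_all only: mult.assoc zero_less_norm_iff norm_eq_zero simp_thms)
    \<comment> \<open>Serves the case \<open>d y = 0\<close>, where \<open>norm (d y)\<close> cannot
      be cancelled. The sign of \<open>B i\<close> is not known, but
      \<open>B i * norm (y - y0)\<close> bounds an absolute value.\<close>
    moreover have "C * norm (y - y0) \<ge> 0" 
    proof -
      have "B i * norm (y - y0) \<ge> 0" if "i \<in> Basis" for i using elim(3) that abs_ge_zero order_trans by blast
      then have "(\<Sum>i\<in>Basis. B i * norm (y - y0)) \<ge> 0" by (rule sum_nonneg)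
      then show ?thesis using k by (simp add: C_def sum_distrib_right[symmetric])
    qed
    ultimately show ?case using k by auto
  qed
  define J where "J \<gamma> = (\<Sum>i\<in>Basis. \<gamma> i *\<^sub>R s i)" for \<gamma> :: "'e \<Rightarrow> real"
  have J: "b (J \<gamma>) z = \<gamma> z" if "linear \<gamma>" for \<gamma> z
  proof -
    have "b (s i) z = i \<bullet> z" for i
      unfolding s_def using b by (rule sharp_works) (simp add: bounded_linear.linear[OF bounded_linear_inner_right])
    then have "b (J \<gamma>) z = (\<Sum>i\<in>Basis. \<gamma> i * (i \<bullet> z))"
      by (simp add: J_def linear_sum[OF posdefD(5)[OF b]] linear_cmul[OF posdefD(5)[OF b]])
    then show ?thesis using linear_euclidean_sum[OF that, of z] by (simp add: inner_commute mult.commute)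
  qed
  have dJ: "d y = J (\<beta> y) - J (\<lambda>i. \<Sum>j\<in>Basis. (d y \<bullet> j) * (G y j i - b j i))" if y: "y \<in> S" for y
  proof -
    note Gl = posdefD(1)[OF pd[OF y]]
    have bil: "bilinear (\<lambda>u v. G y u v - b u v)"
      using posdefD(4,5)[OF b] posdefD(4,5)[OF pd[OF y]]
      by (auto simp: bilinear_def intro: linear_compose_sub)
    have sm: "(\<Sum>j\<in>Basis. (d y \<bullet> j) * (G y j i - b j i)) = G y (d y) i - b (d y) i" for i
      using linear_euclidean_sum[of "\<lambda>u. G y u i - b u i" "d y"] bil by (simp add: bilinear_def)
    have lin: "linear (\<lambda>i. G y (d y) i - b (d y) i)" using bil by (simp add: bilinear_def)
    show ?thesis
      by (rule posdef_nondegenerate[OF b])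
         (simp add: sm bilinear_lsub[OF bl] J[OF lin] J[OF lin\<beta>[OF y]] flip: d[OF y])
  qed
  have "(\<lambda>y. (d y \<bullet> j) * (G y j i - b j i)) differentiable (at y0)" if "j \<in> Basis" for i j
  proof (rule differentiableI, rule has_derivative_zero_mult)
    show "eventually (\<lambda>y. \<bar>d y \<bullet> j\<bar> \<le> C * norm (y - y0)) (nhds y0)"
      using dC by (rule eventually_mono) (use that Basis_le_norm order_trans in blast)
    show "((\<lambda>y. G y j i - b j i) \<longlongrightarrow> 0) (nhds y0)"
      using tendsto_diff[OF cont tendsto_const, of j i "b j i"] by (simp add: b_def)
  qed
  then have "(\<lambda>y. w0 + (J (\<beta> y) - J (\<lambda>i. \<Sum>j\<in>Basis. (d y \<bullet> j) * (G y j i - b j i)))) differentiable (at y0)"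
    unfolding J_def using d\<beta>
    by (intro differentiable_add differentiable_diff differentiable_sum differentiable_scaleR differentiable_const ballI) auto
  moreover have "w0 + (J (\<beta> y) - J (\<lambda>i. \<Sum>j\<in>Basis. (d y \<bullet> j) * (G y j i - b j i))) = sharp (G y) (\<alpha> y)" if "y \<in> S" for y
    using dJ[OF that] unfolding d_def by (metis add_diff_cancel_left' diff_add_cancel add.commute)
  ultimately show ?thesis by (rule differentiable_cong_open[OF _ S])
qed

section \<open>Metrics on an open set\<close>

locale metric_field =
  fixes S :: "'e::euclidean_space set" and G :: "'e \<Rightarrow> 'e \<Rightarrow> 'e \<Rightarrow> real"
  assumes open_S: "open S"
    and posdef_G: "y \<in> S \<Longrightarrow> posdef (G y)"
    and smooth_G: "smooth_on (\<lambda>y. G y u v) S"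
begin

abbreviation dG :: "'e \<Rightarrow> 'e \<Rightarrow> 'e \<Rightarrow> 'e \<Rightarrow> real" where
  "dG y u v w \<equiv> ddir (\<lambda>y. G y u v) y w"

lemmas bilinear_G = posdefD(1)[OF posdef_G]
lemmas G_sym = posdefD(2)[OF posdef_G]

lemmas G_diff = smooth_on_differentiable[OF smooth_G]
lemmas dG_has_derivative = smooth_on_has_derivative[OF smooth_G]
lemmas dG_diff = smooth_on_differentiable[OF smooth_on_ddir[OF smooth_G]]

lemma dG_sym: "y \<in> S \<Longrightarrow> dG y u v w = dG y v u w"
  by (rule ddir_cong_open[OF open_S]) (auto intro: G_sym)

lemma linear_dG3: "y \<in> S \<Longrightarrow> linear (dG y u v)"
  using linear_ddir[OF G_diff] .

lemma linear_dG1: 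
  assumes y: "y \<in> S"
  shows "linear (\<lambda>u. dG y u v w)"
proof (rule linearI)
  fix u u'
  have "dG y (u + u') v w = ddir (\<lambda>y. G y u v + G y u' v) y w"
    by (rule ddir_cong_open[OF open_S y]) (rule bilinear_ladd[OF bilinear_G])
  then show "dG y (u + u') v w = dG y u v w + dG y u' v w"
    using ddir_eqI[OF has_derivative_add[OF dG_has_derivative[OF y] dG_has_derivative[OF y]]] by simp
next
  fix r u
  have "dG y (r *\<^sub>R u) v w = ddir (\<lambda>y. r * G y u v) y w"
    by (rule ddir_cong_open[OF open_S y]) (simp add: bilinear_lmul[OF bilinear_G])
  then show "dG y (r *\<^sub>R u) v w = r *\<^sub>R dG y u v w"
    using ddir_eqI[OF has_derivative_mult_right[OF dG_has_derivative[OF y]]] by simp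
qed

lemma linear_dG2: "y \<in> S \<Longrightarrow> linear (\<lambda>v. dG y u v w)"
  using linear_dG1[of y u w] by (simp add: dG_sym[of y u])

section \<open>The Levi-Civita connection in coordinates\<close>

lemma linear_koszul:
  assumes y: "y \<in> S"
  shows "linear (\<lambda>z. (dG y v z u + dG y u z v - dG y u v z) / 2)"
proof -
  have "linear (\<lambda>z. (1/2) *\<^sub>R (dG y v z u + dG y u z v - dG y u v z))"
    using y by (intro linear_compose_scale_right linear_compose_sub linear_compose_add linear_dG2 linear_dG3)
  then show ?thesis by simp
qed

lemma koszul:
  assumes y: "y \<in> S"
  shows "G y (christoffel G y u v) z = (dG y v z u + dG y u z v - dG y u v z) / 2"
  unfolding christoffel_def using sharp_works[OF posdef_G linear_koszul] y by simp

lemma christoffel_eqI: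
  assumes "y \<in> S" "\<And>z. G y w z = (dG y v z u + dG y u z v - dG y u v z) / 2"
  shows "christoffel G y u v = w"
  unfolding christoffel_def using posdef_G[OF assms(1)] assms(2) by (rule sharp_eqI)

lemma christoffel_sym: "y \<in> S \<Longrightarrow> christoffel G y u v = christoffel G y v u"
  by (rule christoffel_eqI) (simp_all add: koszul dG_sym[of y v u])

lemma linear_christoffel:
  assumes y: "y \<in> S"
  shows "linear (christoffel G y u)"
proof (rule linearI)
  note simps = koszul[OF y] bilinear_ladd[OF bilinear_G[OF y]] bilinear_lmul[OF bilinear_G[OF y]]
    linear_add[OF linear_dG1[OF y]] linear_cmul[OF linear_dG1[OF y]]
    linear_add[OF linear_dG2[OF y]] linear_cmul[OF linear_dG2[OF y]]
    linear_add[OF linear_dG3[OF y]] linear_cmul[OF linear_dG3[OF y]]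
  show "christoffel G y u (v + v') = christoffel G y u v + christoffel G y u v'" for v v'
    by (rule christoffel_eqI[OF y]) (simp add: simps field_simps)
  show "christoffel G y u (r *\<^sub>R v) = r *\<^sub>R christoffel G y u v" for r v
    by (rule christoffel_eqI[OF y]) (simp add: simps field_simps)
qed

lemma bilinear_christoffel:
  assumes y: "y \<in> S"
  shows "bilinear (christoffel G y)"
proof -
  have "linear (\<lambda>u. christoffel G y u v)" for v
    using linear_christoffel[OF y, of v] by (simp add: christoffel_sym[OF y, of _ v])
  then show ?thesis using linear_christoffel[OF y] by (simp add: bilinear_def)
qed

lemma christoffel_diff:
  assumes y: "y \<in> S"
  shows "(\<lambda>y. christoffel G y u v) differentiable (at y)"
  unfolding christoffel_def
  by (rule sharp_differentiable[OF open_S y posdef_G G_diff[OF y] linear_koszul])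
     (auto intro!: differentiable_add differentiable_diff differentiable_divide dG_diff[OF y])

text \<open>Smoothness of the metric is given for constant vectors only, so the product rule for a
  varying \<open>h y\<close> goes through its components.\<close>

lemma has_derivative_G_vector:
  assumes y: "y \<in> S" and h: "(h has_derivative h') (at y)"
  shows "((\<lambda>y. G y (h y) z) has_derivative (\<lambda>w. dG y (h y) z w + G y (h' w) z)) (at y)"
proof -
  have "G x (h x) z = (\<Sum>i\<in>Basis. (h x \<bullet> i) * G x i z)" if "x \<in> S" for x
    using linear_euclidean_sum[OF posdefD(5)[OF posdef_G[OF that]], of "h x" z] by simp
  moreover have "((\<lambda>x. \<Sum>i\<in>Basis. (h x \<bullet> i) * G x i z) has_derivative
     (\<lambda>w. \<Sum>i\<in>Basis. (h y \<bullet> i) * dG y i z w + (h' w \<bullet> i) * G y i z)) (at y)"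
    using h dG_has_derivative[OF y] by (auto intro!: derivative_eq_intros)
  ultimately have "((\<lambda>y. G y (h y) z) has_derivative
     (\<lambda>w. \<Sum>i\<in>Basis. (h y \<bullet> i) * dG y i z w + (h' w \<bullet> i) * G y i z)) (at y)"
    using has_derivative_transform_within_open[OF _ open_S y] by (metis (no_types, lifting))
  moreover have "(\<Sum>i\<in>Basis. (h y \<bullet> i) * dG y i z w + (h' w \<bullet> i) * G y i z) = dG y (h y) z w + G y (h' w) z" for w
    using linear_euclidean_sum[OF posdefD(5)[OF posdef_G[OF y]], of "h' w" z]
      linear_euclidean_sum[OF linear_dG1[OF y], of "h y" z w] by (simp add: sum.distrib)
  ultimately show ?thesis by simp
qed

section \<open>Gradient, Hessian and Laplacian in coordinates\<close>

definition grad :: "('e \<Rightarrow> real) \<Rightarrow> 'e \<Rightarrow> 'e" where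
  "grad h y = sharp (G y) (ddir h y)"

definition hess :: "('e \<Rightarrow> real) \<Rightarrow> 'e \<Rightarrow> 'e \<Rightarrow> 'e \<Rightarrow> real" where
  "hess h y w z = ddir (\<lambda>y. ddir h y z) y w - ddir h y (christoffel G y w z)"

context
  fixes h :: "'e \<Rightarrow> real" assumes h: "smooth_on h S"
begin

lemma linear_ddir_smooth: "y \<in> S \<Longrightarrow> linear (ddir h y)"
  using linear_ddir[OF smooth_on_differentiable[OF h]] .

lemma G_grad: "y \<in> S \<Longrightarrow> G y (grad h y) z = ddir h y z"
  unfolding grad_def by (rule sharp_works[OF posdef_G linear_ddir_smooth])

lemma grad_diff:
  assumes y: "y \<in> S"
  shows "grad h differentiable (at y)"
proof -
  have "(\<lambda>y. sharp (G y) (ddir h y)) differentiable (at y)"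
    by (rule sharp_differentiable[OF open_S y posdef_G G_diff[OF y] linear_ddir_smooth])
       (auto intro!: smooth_on_differentiable[OF smooth_on_ddir[OF h] y])
  then show ?thesis by (simp add: grad_def[abs_def])
qed

text \<open>Compatibility of connection and metric: \<open>G (grad h) z = dh z\<close> is
  differentiated along \<open>w\<close> with \<open>z\<close> constant, and the Koszul terms absorb
  the derivative of the metric.\<close>

lemma G_covariant_derivative_grad:
  assumes y: "y \<in> S"
  shows "G y (ddir (grad h) y w + christoffel G y w (grad h y)) z = hess h y w z"
proof -
  have "ddir (\<lambda>y. ddir h y z) y w = ddir (\<lambda>y. G y (grad h y) z) y w"
    by (rule ddir_cong_open[OF open_S y]) (simp add: G_grad)
  also have "\<dots> = dG y (grad h y) z w + G y (ddir (grad h) y w) z"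
    by (rule ddir_eqI[OF has_derivative_G_vector[OF y has_derivative_ddir[OF grad_diff[OF y]]]])
  finally have "ddir (\<lambda>y. ddir h y z) y w = dG y (grad h y) z w + G y (ddir (grad h) y w) z" .
  moreover have "ddir h y (christoffel G y w z) = (dG y z (grad h y) w + dG y w (grad h y) z - dG y w z (grad h y)) / 2"
    using koszul[OF y, of w z "grad h y"] G_grad[OF y, of "christoffel G y w z"]
      G_sym[OF y, of "grad h y" "christoffel G y w z"] by simp
  ultimately show ?thesis
    by (simp add: hess_def bilinear_ladd[OF bilinear_G[OF y]] koszul[OF y] dG_sym[OF y, of z "grad h y"]
      field_simps)
qed

text \<open>The trace is what the Ricci tensor of the warped product produces; the frame sum is the
  form that the maximum principle handles.\<close>

lemma laplacian_orthonormal_frame: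
  assumes y: "y \<in> S" and E: "orthonormal_frame (G y) E"
  shows "trace (\<lambda>w. ddir (grad h) y w + christoffel G y w (grad h y)) = (\<Sum>e\<in>E. hess h y e e)"
proof -
  have "linear (\<lambda>w. ddir (grad h) y w + christoffel G y w (grad h y))"
    using bilinear_christoffel[OF y] linear_ddir[OF grad_diff[OF y]]
    by (intro linear_compose_add) (auto simp: bilinear_def)
  from trace_orthonormal_frame[OF posdef_G[OF y] E this] show ?thesis
    by (simp only: G_covariant_derivative_grad[OF y])
qed

end

end

section \<open>The strong maximum principle\<close>

text \<open>If \<open>d2 e\<close> were positive, the derivative along \<open>e\<close>, which is
  zero at \<open>y\<close>, would be positive just ahead of \<open>y\<close>, and by the mean value
  theorem \<open>h\<close> would exceed its maximum.\<close>

lemma second_derivative_test_max: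
  fixes h :: "'e::euclidean_space \<Rightarrow> real"
  assumes S: "open S" "y \<in> S"
    and h: "\<And>x. x \<in> S \<Longrightarrow> (h has_derivative dh x) (at x)"
    and dh: "((\<lambda>x. dh x e) has_derivative (\<lambda>w. d2 w)) (at y)"
    and max: "\<And>x. x \<in> S \<Longrightarrow> h x \<le> h y"
  shows "dh y e = 0" "d2 e \<le> 0"
proof -
  obtain r where r: "r > 0" "ball y r \<subseteq> S" using S open_contains_ball by blast
  have "dh y = (\<lambda>v. 0)"
  proof (rule has_derivative_local_max[OF h[OF S(2)]])
    show "\<forall>\<^sub>F x in at y. h x \<le> h y"
      using eventually_at_in_open'[OF S] by (rule eventually_mono) (rule max)
  qed
  then show dh0: "dh y e = 0" by simp
  show "d2 e \<le> 0"
  proof (rule ccontr)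
    assume pos: "\<not> d2 e \<le> 0"
    have lin: "linear d2" using dh has_derivative_linear by blast
    have pos: "d2 e > 0" using pos by simp
    then have e0: "e \<noteq> 0" using linear_0[OF lin] by auto
    have line: "((\<lambda>t. y + t *\<^sub>R e) has_derivative (\<lambda>t. t *\<^sub>R e)) (at t)" for t :: real
      by (auto intro!: derivative_eq_intros)
    have "((\<lambda>t. dh (y + t *\<^sub>R e) e) has_derivative (\<lambda>t. d2 (t *\<^sub>R e))) (at (0::real))"
      using has_derivative_compose[OF line, of "\<lambda>x. dh x e" d2 0] dh by simp
    then have "DERIV (\<lambda>t. dh (y + t *\<^sub>R e) e) 0 :> d2 e"
      by (simp add: has_field_derivative_def linear_cmul[OF lin] mult_commute_abs)
    from DERIV_pos_inc_right[OF this pos] obtain s where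
      s: "s > 0" "\<And>t. 0 < t \<Longrightarrow> t < s \<Longrightarrow> 0 < dh (y + t *\<^sub>R e) e"
      using dh0 by auto
    define t where "t = min (s/2) (r / (2 * norm e))"
    have t: "t > 0" "t < s" using s r e0 by (auto simp: t_def)
    have "t * norm e \<le> r / 2" using e0 by (auto simp: t_def min_def field_simps)
    then have inS: "y + x *\<^sub>R e \<in> S" if "0 \<le> x" "x \<le> t" for x
    proof -
      have "x * norm e \<le> t * norm e" using that by (intro mult_right_mono) auto
      then have "x * norm e < r" using \<open>t * norm e \<le> r/2\<close> r(1) by linarith
      then show ?thesis using that r(2) by (auto simp: dist_norm subset_iff)
    qed
    have der: "DERIV (\<lambda>t. h (y + t *\<^sub>R e)) x :> dh (y + x *\<^sub>R e) e" if "0 \<le> x" "x \<le> t" for x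
    proof -
      have "linear (dh (y + x *\<^sub>R e))" using h[OF inS[OF that]] has_derivative_linear by blast
      then show ?thesis using has_derivative_compose[OF line h[OF inS[OF that]]]
        by (simp add: has_field_derivative_def linear_cmul mult_commute_abs)
    qed
    obtain x where "0 < x" "x < t" "h (y + t *\<^sub>R e) - h (y + 0 *\<^sub>R e) = (t - 0) * dh (y + x *\<^sub>R e) e"
      using MVT2[OF t(1), of "\<lambda>t. h (y + t *\<^sub>R e)" "\<lambda>x. dh (y + x *\<^sub>R e) e"] der by auto
    then have "h (y + t *\<^sub>R e) > h y" using s(2)[of x] t by (simp add: algebra_simps)
    then show False using max[OF inS[of t]] t by auto
  qed
qed

text \<open>Hopf's argument: near a non-maximum point \<open>y1\<close>, a ball touching the maximum
  set only at \<open>z\<close> carries a barrier which, added to \<open>u\<close>, produces an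
  interior maximum where the operator is positive. \<open>E\<close> encodes the coefficient matrix,
  the sum of all \<open>e e^T\<close>, and \<open>b\<close> the drift; both may jump with
  \<open>y\<close>, only \<open>k\<close> and \<open>K\<close> are uniform.\<close>

lemma strong_maximum_principle:
  fixes u :: "'e::euclidean_space \<Rightarrow> real"
  assumes S: "open S" "y0 \<in> S"
    and du: "\<And>y. y \<in> S \<Longrightarrow> (u has_derivative du y) (at y)"
    and d2u: "\<And>y v. y \<in> S \<Longrightarrow> ((\<lambda>y. du y v) has_derivative d2u y v) (at y)"
    and k: "k > 0" 
    and ell: "\<And>y. y \<in> S \<Longrightarrow> \<exists>E b. norm b \<le> K \<and> (\<Sum>e\<in>E. (norm e)\<^sup>2) \<le> K \<and>
           (\<forall>\<xi>. k * (norm \<xi>)\<^sup>2 \<le> (\<Sum>e\<in>E. (\<xi> \<bullet> e)\<^sup>2)) \<and> (\<Sum>e\<in>E. d2u y e e) + du y b \<ge> 0"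
    and max: "\<And>y. y \<in> S \<Longrightarrow> u y \<le> u y0"
  shows "\<exists>\<delta>>0. \<forall>y\<in>ball y0 \<delta>. u y = u y0"
proof -
  \<comment> \<open>Room for the construction: \<open>y1\<close> lies within \<open>r\<close> of
    \<open>y0\<close>, the nearest maximum point \<open>z\<close> within \<open>2 * r\<close>, and
    the small ball about \<open>z\<close> within \<open>3 * r\<close>.\<close>
  obtain r where r: "r > 0" "cball y0 (3 * r) \<subseteq> S"
  proof -
    obtain r' where "r' > 0" "cball y0 r' \<subseteq> S" using S open_contains_cball by blast
    then show ?thesis using that[of "r'/3"] by auto
  qed
  have contu: "continuous_on S u"
    using du has_derivative_continuous by (metis continuous_at_imp_continuous_on)
  define M where "M = {y \<in> cball y0 (2 * r). u y = u y0}"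
  have "closed M" unfolding M_def
  proof (rule continuous_closed_preimage_constant)
    have "cball y0 (2 * r) \<subseteq> S" using r by auto
    then show "continuous_on (cball y0 (2 * r)) u" using contu continuous_on_subset by blast
  qed simp
  have "y0 \<in> M" using r by (simp add: M_def)
  have "u y1 = u y0" if y1: "y1 \<in> ball y0 r" for y1
  proof (rule ccontr)
    assume ne: "u y1 \<noteq> u y0"
    obtain z where z: "z \<in> M" "\<And>y. y \<in> M \<Longrightarrow> dist y1 z \<le> dist y1 y"
      using distance_attains_inf[OF \<open>closed M\<close>, of y1] \<open>y0 \<in> M\<close> by blast
    define x where "x = midpoint y1 z"
    define \<rho> where "\<rho> = dist x z"
    have zy1: "dist y1 z < r" using z(2)[OF \<open>y0 \<in> M\<close>] y1 by (simp add: dist_commute)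
    have zy0: "dist y0 z < 2 * r" using zy1 y1 dist_triangle[of y0 z y1] by simp
    have uz: "u z = u y0" using z(1) by (simp add: M_def)
    have "z \<noteq> y1" using ne uz by auto
    have rho: "\<rho> = dist y1 z / 2" by (simp add: \<rho>_def x_def dist_midpoint)
    have xy1: "dist y1 x = \<rho>" by (simp add: rho x_def dist_midpoint)
    have rho_pos: "\<rho> > 0" using \<open>z \<noteq> y1\<close> by (simp add: rho)
    have rho_r: "\<rho> < r / 2" using zy1 by (simp add: rho)
    text \<open>Passing to the midpoint makes \<open>z\<close> the only maximum point on the closed ball.\<close>
    have only: "u y < u y0" if "y \<in> cball x \<rho>" "y \<noteq> z" for y
    proof -
      have dx: "dist x y \<le> \<rho>" using that by simp
      have le: "dist y1 y \<le> dist y1 z" using dist_triangle[of y1 y x] xy1 dx rho by simp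
      have "dist y0 y \<le> dist y0 y1 + dist y1 y" by (rule dist_triangle)
      then have y2: "y \<in> cball y0 (2 * r)" using le zy1 y1 by simp
      then have yS: "y \<in> S" using r by auto
      have "u y \<noteq> u y0"
      proof
        assume "u y = u y0"
        then have "y \<in> M" using y2 by (simp add: M_def)
        then have eq: "dist y1 y = 2 * \<rho>" using z(2) le rho by fastforce
        have xy: "dist x y = \<rho>" using eq xy1 dx dist_triangle[of y1 y x] by auto
        \<comment> \<open>Equality in the triangle inequality puts \<open>y\<close> on the ray from
          \<open>y1\<close> through \<open>x\<close>, at distance \<open>\<rho>\<close> beyond
          \<open>x\<close>; that point is \<open>z\<close>.\<close>
        have "norm ((x - y1) + (y - x)) = norm (x - y1) + norm (y - x)"
          using eq xy xy1 by (simp add: dist_norm norm_minus_commute)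
        then have "norm (x - y1) *\<^sub>R (y - x) = norm (y - x) *\<^sub>R (x - y1)"
          unfolding norm_triangle_eq .
        then have "y - x = x - y1"
          using xy xy1 rho_pos by (simp add: dist_norm norm_minus_commute)
        then have "y = z" unfolding x_def midpoint_def
          by (simp add: algebra_simps scaleR_2[symmetric])
        then show False using that by simp
      qed
      then show ?thesis using max[OF yS] by simp
    qed
    text \<open>
      Hopf's barrier \<open>v\<close> vanishes on the sphere through \<open>z\<close>; \<open>\<alpha>\<close> is so large that the second-order
      terms dominate and \<open>v\<close> is a strict subsolution near \<open>z\<close>.
    \<close>
    define \<alpha> where "\<alpha> = (K * (1 + 2 * \<rho>) + 1) * 2 / (k * \<rho>\<^sup>2)"
    have "K \<ge> 0" using ell[OF S(2)] norm_ge_zero order_trans by blast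
    then have alpha: "\<alpha> > 0" using rho_pos k by (auto simp: \<alpha>_def intro!: divide_pos_pos add_nonneg_pos)
    define X where "X y = exp (- \<alpha> * ((y - x) \<bullet> (y - x)))" for y
    define v where "v y = X y - exp (- \<alpha> * \<rho>\<^sup>2)" for y
    define dv where "dv y w = X y * (- 2 * \<alpha> * ((y - x) \<bullet> w))" for y w
    define d2v where "d2v y w w' = X y * (4 * \<alpha>\<^sup>2 * ((y - x) \<bullet> w) * ((y - x) \<bullet> w') - 2 * \<alpha> * (w \<bullet> w'))" for y w w'
    have dX: "(X has_derivative dv y) (at y)" for y
      unfolding X_def dv_def by (auto intro!: derivative_eq_intros simp: algebra_simps inner_commute)
    have dv: "(v has_derivative dv y) (at y)" for y
      unfolding v_def using has_derivative_diff[OF dX has_derivative_const] by simp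
    have ddv: "((\<lambda>y. dv y w) has_derivative d2v y w) (at y)" for y w
      unfolding dv_def d2v_def
      by (rule derivative_eq_intros dX refl)+ (auto simp: dv_def algebra_simps power2_eq_square inner_commute)
    have v1: "v y \<le> 1" for y
    proof -
      have "X y \<le> 1" unfolding X_def using alpha by simp
      then show ?thesis using exp_gt_zero[of "- \<alpha> * \<rho>\<^sup>2"] unfolding v_def by linarith
    qed
    have v_out: "v y \<le> 0" if "y \<notin> ball x \<rho>" for y
    proof -
      have "\<rho>\<^sup>2 \<le> (norm (y - x))\<^sup>2" using that rho_pos by (intro power_mono) (auto simp: dist_norm norm_minus_commute)
      then show ?thesis using alpha by (simp add: v_def X_def dot_square_norm)
    qed
    have vz: "v z = 0" by (simp add: v_def X_def dot_square_norm \<rho>_def dist_norm norm_minus_commute)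
    have DS: "cball z (\<rho> / 2) \<subseteq> S"
    proof
      fix y assume "y \<in> cball z (\<rho> / 2)"
      then have "dist y0 y < 3 * r" using zy0 rho_r dist_triangle[of y0 y z] rho_pos by simp
      then show "y \<in> S" using r by auto
    qed
    have pos: "(\<Sum>e\<in>E. d2v y e e) + dv y b > 0"
      if "y \<in> cball z (\<rho> / 2)" and b: "norm b \<le> K" "(\<Sum>e\<in>E. (norm e)\<^sup>2) \<le> K"
        and E: "\<forall>\<xi>. k * (norm \<xi>)\<^sup>2 \<le> (\<Sum>e\<in>E. (\<xi> \<bullet> e)\<^sup>2)" for y b E
    proof -
      define \<xi> where "\<xi> = y - x"
      \<comment> \<open>The gradient of the barrier vanishes at the center \<open>x\<close>; the
        radius \<open>\<rho> / 2\<close> of the ball about \<open>z\<close> keeps \<open>y\<close>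
        away from it.\<close>
      have lo: "norm \<xi> \<ge> \<rho> / 2" using that(1) \<rho>_def dist_triangle[of x z y]
        by (simp add: \<xi>_def dist_norm norm_minus_commute)
      have "dist x y \<le> 2 * \<rho>" using that(1) \<rho>_def dist_triangle[of x y z] rho_pos
        unfolding mem_cball by linarith
      then have hi: "norm \<xi> \<le> 2 * \<rho>" by (simp add: \<xi>_def dist_norm norm_minus_commute)
      have "\<xi> \<bullet> b \<le> norm \<xi> * norm b" by (rule norm_cauchy_schwarz)
      also have "\<dots> \<le> 2 * \<rho> * K" using hi b rho_pos by (intro mult_mono) auto
      finally have 1: "\<xi> \<bullet> b \<le> 2 * \<rho> * K" .
      have "k * (\<rho> / 2)\<^sup>2 \<le> k * (norm \<xi>)\<^sup>2" using k lo rho_pos by (intro mult_left_mono power_mono) auto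
      also have "\<dots> \<le> (\<Sum>e\<in>E. (\<xi> \<bullet> e)\<^sup>2)" using E by blast
      finally have "2 * \<alpha> * (k * (\<rho> / 2)\<^sup>2) \<le> 2 * \<alpha> * (\<Sum>e\<in>E. (\<xi> \<bullet> e)\<^sup>2)"
        using alpha by (intro mult_left_mono) auto
      \<comment> \<open>Here \<open>K\<close> pays for the frame norms,
        \<open>2 * \<rho> * K\<close> for the drift, and the remaining 1 makes the inequality
        strict.\<close>
      moreover have "2 * \<alpha> * (k * (\<rho> / 2)\<^sup>2) = K * (1 + 2 * \<rho>) + 1"
        using k rho_pos by (simp add: \<alpha>_def power2_eq_square field_simps)
      ultimately have "2 * \<alpha> * (\<Sum>e\<in>E. (\<xi> \<bullet> e)\<^sup>2) - (\<Sum>e\<in>E. (norm e)\<^sup>2) - \<xi> \<bullet> b > 0"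
        using 1 b by (simp add: algebra_simps)
      then have "X y * (2 * \<alpha> * (2 * \<alpha> * (\<Sum>e\<in>E. (\<xi> \<bullet> e)\<^sup>2) - (\<Sum>e\<in>E. (norm e)\<^sup>2) - \<xi> \<bullet> b)) > 0"
        using alpha by (simp add: X_def)
      also have "X y * (2 * \<alpha> * (2 * \<alpha> * (\<Sum>e\<in>E. (\<xi> \<bullet> e)\<^sup>2) - (\<Sum>e\<in>E. (norm e)\<^sup>2) - \<xi> \<bullet> b))
          = (\<Sum>e\<in>E. d2v y e e) + dv y b"
      proof -
        have "d2v y e e = (X y * 4 * \<alpha>\<^sup>2) * (\<xi> \<bullet> e)\<^sup>2 - (X y * 2 * \<alpha>) * (norm e)\<^sup>2" for e
          by (simp add: d2v_def \<xi>_def dot_square_norm power2_eq_square algebra_simps)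
        then have "(\<Sum>e\<in>E. d2v y e e) =
            (X y * 4 * \<alpha>\<^sup>2) * (\<Sum>e\<in>E. (\<xi> \<bullet> e)\<^sup>2) - (X y * 2 * \<alpha>) * (\<Sum>e\<in>E. (norm e)\<^sup>2)"
          by (simp add: sum_subtractf sum_distrib_left)
        then show ?thesis by (simp add: dv_def \<xi>_def power2_eq_square algebra_simps)
      qed
      finally show ?thesis .
    qed
    \<comment> \<open>On the part of the small sphere where \<open>v\<close> may be positive,
      \<open>u\<close> is below its maximum since \<open>z\<close> is not there. Compactness gives a
      uniform gap \<open>\<epsilon>\<close>, and \<open>v \<le> 1\<close> then keeps
      \<open>u + \<epsilon> v\<close> at most \<open>u z\<close>.\<close>
    define C where "C = sphere z (\<rho> / 2) \<inter> cball x \<rho>"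
    have "\<exists>\<epsilon>>0. \<forall>y\<in>C. u y \<le> u y0 - \<epsilon>"
    proof (cases "C = {}")
      case True
      then show ?thesis by (auto intro: exI[of _ 1])
    next
      case False
      have "compact C" unfolding C_def by (intro compact_Int compact_sphere compact_cball)
      moreover have "C \<subseteq> S" using DS by (auto simp: C_def)
      then have "continuous_on C u" using contu continuous_on_subset by blast
      ultimately obtain y where y: "y \<in> C" "\<forall>y'\<in>C. u y' \<le> u y"
        using continuous_attains_sup[of C u] False by blast
      have "u y < u y0" using y(1) rho_pos by (intro only) (auto simp: C_def)
      then show ?thesis using y by (intro exI[of _ "u y0 - u y"]) auto
    qed
    then obtain \<epsilon> where eps: "\<epsilon> > 0" "\<And>y. y \<in> C \<Longrightarrow> u y \<le> u y0 - \<epsilon>" by blast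
    define h where "h y = u y + \<epsilon> * v y" for y
    have h_sphere: "h y \<le> h z" if "y \<in> sphere z (\<rho> / 2)" for y
    proof (cases "y \<in> ball x \<rho>")
      case True
      then have "u y \<le> u y0 - \<epsilon>" using that by (intro eps) (auto simp: C_def)
      moreover have "\<epsilon> * v y \<le> \<epsilon>" using eps(1) v1[of y] by simp
      ultimately show ?thesis by (simp add: h_def vz uz)
    next
      case False
      have "y \<in> S" using that DS by auto
      moreover have "\<epsilon> * v y \<le> 0" using eps(1) v_out[OF False] by (simp add: mult_nonneg_nonpos)
      ultimately show ?thesis using max[of y] by (simp add: h_def vz uz)
    qed
    have dh: "(h has_derivative (\<lambda>w. du y w + \<epsilon> * dv y w)) (at y)" if "y \<in> S" for y
      unfolding h_def using du[OF that] dv by (auto intro!: derivative_eq_intros)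
    have ddh: "((\<lambda>y. du y w + \<epsilon> * dv y w) has_derivative (\<lambda>e. d2u y w e + \<epsilon> * d2v y w e)) (at y)" if "y \<in> S" for y w
      using d2u[OF that] ddv by (auto intro!: derivative_eq_intros)
    have "continuous_on (cball z (\<rho> / 2)) h"
      using dh DS has_derivative_continuous by (metis continuous_at_imp_continuous_on subsetD)
    then obtain p' where p': "p' \<in> cball z (\<rho> / 2)" "\<forall>y\<in>cball z (\<rho> / 2). h y \<le> h p'"
      using continuous_attains_sup[of "cball z (\<rho> / 2)" h] rho_pos by auto
    \<comment> \<open>A maximum attained on the boundary sphere is also attained at the center
      \<open>z\<close>, so an interior maximum point is available.\<close>
    define p where "p = (if p' \<in> ball z (\<rho> / 2) then p' else z)"
    have p: "p \<in> ball z (\<rho> / 2)" using rho_pos by (simp add: p_def)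
    have p_max: "h y \<le> h p" if "y \<in> ball z (\<rho> / 2)" for y
    proof -
      have "h y \<le> h p'" using p'(2) that by auto
      moreover have "h p' \<le> h p"
        using p'(1) h_sphere[of p'] by (cases "p' \<in> ball z (\<rho> / 2)") (auto simp: p_def)
      ultimately show ?thesis by simp
    qed
    have pS: "p \<in> S" using p DS by auto
    have bS: "y \<in> S" if "y \<in> ball z (\<rho> / 2)" for y using that DS by auto
    have crit: "du p e + \<epsilon> * dv p e = 0" "d2u p e e + \<epsilon> * d2v p e e \<le> 0" for e
      using second_derivative_test_max[OF open_ball p dh[OF bS] ddh[OF pS] p_max] by blast+
    obtain E b where Eb: "norm b \<le> K" "(\<Sum>e\<in>E. (norm e)\<^sup>2) \<le> K"
        "\<forall>\<xi>. k * (norm \<xi>)\<^sup>2 \<le> (\<Sum>e\<in>E. (\<xi> \<bullet> e)\<^sup>2)" "(\<Sum>e\<in>E. d2u p e e) + du p b \<ge> 0"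
      using ell[OF pS] by blast
    \<comment> \<open>With the frame and drift belonging to \<open>p\<close>, the operator is at
      most 0 on \<open>h\<close>, against at least 0 on \<open>u\<close> and more than 0 on
      \<open>v\<close>.\<close>
    have "(\<Sum>e\<in>E. d2u p e e + \<epsilon> * d2v p e e) \<le> 0" using crit(2) by (simp add: sum_nonpos)
    then have "(\<Sum>e\<in>E. d2u p e e) + du p b + \<epsilon> * ((\<Sum>e\<in>E. d2v p e e) + dv p b) \<le> 0"
      using crit(1)[of b] by (simp add: sum.distrib sum_distrib_left algebra_simps)
    moreover have "(\<Sum>e\<in>E. d2v p e e) + dv p b > 0" using p by (intro pos Eb) auto
    ultimately show False using Eb(4) eps(1) by (smt (verit) mult_pos_pos)
  qed
  then show ?thesis using r by blast
qed

context metric_field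
begin

text \<open>In coordinates the Laplacian is the frame sum of second derivatives minus
  \<open>dF\<close> of the summed Christoffel vectors; the latter join \<open>X\<close> in the
  drift. A smaller neighbourhood \<open>U\<close> provides uniform bounds.\<close>

lemma strong_maximum_principle_laplacian:
  assumes y0: "y0 \<in> S" and F: "smooth_on F S" and X: "isCont X y0"
    and eq: "\<And>y E. y \<in> S \<Longrightarrow> orthonormal_frame (G y) E \<Longrightarrow> (\<Sum>e\<in>E. hess F y e e) + ddir F y (X y) = 0"
    and max: "\<And>y. y \<in> S \<Longrightarrow> F y \<le> F y0"
  shows "\<exists>\<delta>>0. \<forall>y\<in>ball y0 \<delta>. F y = F y0"
proof -
  have evS: "eventually (\<lambda>y. y \<in> S) (nhds y0)" using y0 open_S eventually_nhds by blast
  have cont: "((\<lambda>y. G y u v) \<longlongrightarrow> G y0 u v) (nhds y0)" for u v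
    using differentiable_imp_continuous_within[OF G_diff[OF y0]] by (simp add: continuous_within tendsto_nhds_iff)
  obtain k K where k: "k > 0" and K: "K > 0"
    and ell: "eventually (\<lambda>y. \<forall>w. k * (norm w)\<^sup>2 \<le> G y w w \<and> G y w w \<le> K * (norm w)\<^sup>2) (nhds y0)"
    using posdef_eventually_elliptic[OF eventually_mono[OF evS posdef_G] cont] by blast
  define m where "m y = (\<Sum>i\<in>Basis. \<Sum>j\<in>Basis. norm (christoffel G y i j))" for y
  have contC: "((\<lambda>y. christoffel G y u v) \<longlongrightarrow> christoffel G y0 u v) (nhds y0)" for u v
    using differentiable_imp_continuous_within[OF christoffel_diff[OF y0]] by (simp add: continuous_within tendsto_nhds_iff)
  have "(m \<longlongrightarrow> m y0) (nhds y0)"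
    unfolding m_def by (intro tendsto_intros contC)
  then have evm: "eventually (\<lambda>y. m y < m y0 + 1) (nhds y0)" by (rule order_tendstoD) simp
  have "(X \<longlongrightarrow> X y0) (nhds y0)" using X by (simp add: isCont_def tendsto_nhds_iff)
  then have "((\<lambda>y. norm (X y)) \<longlongrightarrow> norm (X y0)) (nhds y0)" by (rule tendsto_norm)
  then have evX: "eventually (\<lambda>y. norm (X y) < norm (X y0) + 1) (nhds y0)" by (rule order_tendstoD) simp
  \<comment> \<open>The larger of the bounds for the frame norms and for the drift. \<open>m\<close>
    dominates the Christoffel map; each \<open>+ 1\<close> is slack from continuity at
    \<open>y0\<close>.\<close>
  define C where "C = max (real DIM('e) / k) (norm (X y0) + 1 + (m y0 + 1) * (real DIM('e) / k))"
  have "eventually (\<lambda>y. y \<in> S \<and> (\<forall>w. k * (norm w)\<^sup>2 \<le> G y w w \<and> G y w w \<le> K * (norm w)\<^sup>2) \<and>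
     m y < m y0 + 1 \<and> norm (X y) < norm (X y0) + 1) (nhds y0)"
    using evS ell evm evX by eventually_elim blast
  then obtain U where U: "open U" "y0 \<in> U" and US: "\<And>y. y \<in> U \<Longrightarrow> y \<in> S"
    and ellU: "\<And>y w. y \<in> U \<Longrightarrow> k * (norm w)\<^sup>2 \<le> G y w w" "\<And>y w. y \<in> U \<Longrightarrow> G y w w \<le> K * (norm w)\<^sup>2"
    and mU: "\<And>y. y \<in> U \<Longrightarrow> m y < m y0 + 1" and XU: "\<And>y. y \<in> U \<Longrightarrow> norm (X y) < norm (X y0) + 1"
    unfolding eventually_nhds by blast
  have m0: "m y0 \<ge> 0" by (auto simp: m_def intro!: sum_nonneg)
  show ?thesis
  proof (rule strong_maximum_principle[OF U])
    fix y assume y: "y \<in> U"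
    note yS = US[OF y]
    show "(F has_derivative ddir F y) (at y)" by (rule smooth_on_has_derivative[OF F yS])
    show "((\<lambda>y. ddir F y v) has_derivative ddir (\<lambda>y. ddir F y v) y) (at y)" for v
      by (rule smooth_on_has_derivative[OF smooth_on_ddir[OF F] yS])
    show "F y \<le> F y0" by (rule max[OF yS])
    obtain E where E: "orthonormal_frame (G y) E" using orthonormal_frame_exists[OF posdef_G[OF yS]] by blast
    define b where "b = X y - (\<Sum>e\<in>E. christoffel G y e e)"
    have nE: "(\<Sum>e\<in>E. (norm e)\<^sup>2) \<le> real DIM('e) / k"
      by (rule orthonormal_frame_norm_bound[OF E k ellU(1)[OF y]])
    have "norm (\<Sum>e\<in>E. christoffel G y e e) \<le> (\<Sum>e\<in>E. m y * (norm e)\<^sup>2)"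
      using bilinear_bound[OF bilinear_christoffel[OF yS]]
      by (intro order_trans[OF norm_sum] sum_mono) (simp add: m_def power2_eq_square)
    also have "\<dots> \<le> (m y0 + 1) * (real DIM('e) / k)"
      unfolding sum_distrib_left[symmetric]
      using mU[OF y] m0 nE by (intro mult_mono) (auto intro: sum_nonneg)
    finally have "norm b \<le> C" unfolding b_def C_def
      using XU[OF y] norm_triangle_ineq4[of "X y" "\<Sum>e\<in>E. christoffel G y e e"] by linarith
    moreover have "(\<Sum>e\<in>E. (norm e)\<^sup>2) \<le> C" using nE by (simp add: C_def)
    moreover have "\<forall>\<xi>. (1 / K) * (norm \<xi>)\<^sup>2 \<le> (\<Sum>e\<in>E. (\<xi> \<bullet> e)\<^sup>2)"
      using orthonormal_frame_coercive[OF posdef_G[OF yS] E K ellU(2)[OF y]] by blast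
    moreover have "(\<Sum>e\<in>E. ddir (\<lambda>y. ddir F y e) y e) + ddir F y b = 0"
      using eq[OF yS E] by (simp add: b_def hess_def sum_subtractf linear_diff[OF linear_ddir_smooth[OF F yS]]
        linear_sum[OF linear_ddir_smooth[OF F yS]])
    ultimately show "\<exists>E b. norm b \<le> C \<and> (\<Sum>e\<in>E. (norm e)\<^sup>2) \<le> C \<and>
        (\<forall>\<xi>. (1 / K) * (norm \<xi>)\<^sup>2 \<le> (\<Sum>e\<in>E. (\<xi> \<bullet> e)\<^sup>2)) \<and>
        (\<Sum>e\<in>E. ddir (\<lambda>y. ddir F y e) y e) + ddir F y b \<ge> 0"
      by (intro exI[of _ E] exI[of _ b]) auto
  qed (use K in simp)
qed

end


section \<open>Warped products of coordinate metrics\<close>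

locale warped_field = B: metric_field S G + F: metric_field T H
  for S :: "'n::euclidean_space set" and G and T :: "'m::euclidean_space set" and H +
  fixes f :: "'n \<Rightarrow> real" and W :: "'n \<times> 'm \<Rightarrow> 'n \<times> 'm \<Rightarrow> 'n \<times> 'm \<Rightarrow> real"
  assumes smooth_f: "smooth_on f S"
    and f_pos: "y \<in> S \<Longrightarrow> f y > 0"
    and W_eq: "y \<in> S \<Longrightarrow> z \<in> T \<Longrightarrow>
      W (y, z) u v = G y (fst u) (fst v) + (f y)\<^sup>2 * H z (snd u) (snd v)"
begin

lemma open_ST: "open (S \<times> T)"
  by (rule open_Times[OF B.open_S F.open_S])

lemmas f_has_derivative = smooth_on_has_derivative[OF smooth_f]

lemma posdef_W:
  assumes "y \<in> S" "z \<in> T"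
  shows "posdef (W (y, z))"
proof -
  have W: "W (y, z) = (\<lambda>u v. G y (fst u) (fst v) + (f y)\<^sup>2 * H z (snd u) (snd v))"
    using W_eq[OF assms] by blast
  note b = B.bilinear_G[OF assms(1)] F.bilinear_G[OF assms(2)]
  have "bilinear (W (y, z))"
    unfolding W bilinear_def
    by (auto intro!: linearI simp: b[THEN bilinear_ladd] b[THEN bilinear_radd]
        b[THEN bilinear_lmul] b[THEN bilinear_rmul] algebra_simps)
  moreover have "W (y, z) u v = W (y, z) v u" for u v
    unfolding W by (simp add: B.G_sym[OF assms(1), of "fst u"] F.G_sym[OF assms(2), of "snd u"])
  moreover have "W (y, z) u u > 0" if "u \<noteq> 0" for u
  proof -
    have G: "G y (fst u) (fst u) \<ge> 0" "fst u \<noteq> 0 \<Longrightarrow> G y (fst u) (fst u) > 0"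
      using posdefD(3)[OF B.posdef_G[OF assms(1)], of "fst u"] bilinear_lzero[OF b(1)]
      by (cases "fst u = 0"; auto)+
    have H: "H z (snd u) (snd u) \<ge> 0" "snd u \<noteq> 0 \<Longrightarrow> H z (snd u) (snd u) > 0"
      using posdefD(3)[OF F.posdef_G[OF assms(2)], of "snd u"] bilinear_lzero[OF b(2)]
      by (cases "snd u = 0"; auto)+
    have "fst u \<noteq> 0 \<or> snd u \<noteq> 0" using that by (metis prod.collapse zero_prod_def)
    then show ?thesis unfolding W using G H f_pos[OF assms(1)]
      by (auto intro: add_pos_nonneg add_nonneg_pos)
  qed
  ultimately show ?thesis by (simp add: posdef_def)
qed

lemma ddir_W:
  assumes y: "y \<in> S" and z: "z \<in> T"
  shows "ddir (\<lambda>p. W p u v) (y, z) w = B.dG y (fst u) (fst v) (fst w)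
    + 2 * f y * ddir f y (fst w) * H z (snd u) (snd v) + (f y)\<^sup>2 * F.dG z (snd u) (snd v) (snd w)"
proof -
  have "ddir (\<lambda>p. W p u v) (y, z) w =
      ddir (\<lambda>p. G (fst p) (fst u) (fst v) + (f (fst p))\<^sup>2 * H (snd p) (snd u) (snd v)) (y, z) w"
    by (rule ddir_cong_open[OF open_ST]) (use y z in \<open>auto simp: W_eq\<close>)
  also have "\<dots> = (\<lambda>w. B.dG y (fst u) (fst v) (fst w)
    + 2 * f y * ddir f y (fst w) * H z (snd u) (snd v) + (f y)\<^sup>2 * F.dG z (snd u) (snd v) (snd w)) w"
    by (rule ddir_eqI) (auto intro!: derivative_eq_intros has_derivative_fst_comp[OF B.dG_has_derivative[OF y]]
         has_derivative_snd_comp[OF F.dG_has_derivative[OF z]] has_derivative_fst_comp[OF f_has_derivative[OF y]] simp: algebra_simps)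
  finally show ?thesis .
qed

text \<open>O'Neill's formulas for a warped product, verified by pairing with an arbitrary
  \<open>w\<close>. The derivative of \<open>f^2\<close> gives the gradient term for two vertical
  vectors and the \<open>df / f\<close> terms for mixed ones.\<close>

lemma christoffel_W:
  assumes y: "y \<in> S" and z: "z \<in> T"
  shows "christoffel W (y, z) u v =
    (christoffel G y (fst u) (fst v) - (f y * H z (snd u) (snd v)) *\<^sub>R B.grad f y,
     christoffel H z (snd u) (snd v) + (ddir f y (fst u) / f y) *\<^sub>R snd v + (ddir f y (fst v) / f y) *\<^sub>R snd u)"
  unfolding christoffel_def[of W]
proof (rule sharp_eqI[OF posdef_W[OF y z]])
  fix w
  have "f y > 0" by (rule f_pos[OF y])
  note lin = bilinear_ladd[OF B.bilinear_G[OF y]] bilinear_lsub[OF B.bilinear_G[OF y]] bilinear_lmul[OF B.bilinear_G[OF y]]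
    bilinear_ladd[OF F.bilinear_G[OF z]] bilinear_lmul[OF F.bilinear_G[OF z]]
  show "W (y, z) (christoffel G y (fst u) (fst v) - (f y * H z (snd u) (snd v)) *\<^sub>R B.grad f y,
     christoffel H z (snd u) (snd v) + (ddir f y (fst u) / f y) *\<^sub>R snd v + (ddir f y (fst v) / f y) *\<^sub>R snd u) w =
    (ddir (\<lambda>y. W y v w) (y, z) u + ddir (\<lambda>y. W y u w) (y, z) v - ddir (\<lambda>y. W y u v) (y, z) w) / 2"
    unfolding ddir_W[OF y z] W_eq[OF y z] using \<open>f y > 0\<close>
    by (simp add: lin B.koszul[OF y] F.koszul[OF z] B.G_grad[OF smooth_f y] field_simps power2_eq_square)
qed

lemma zero_simps:
  assumes "y \<in> S" "z \<in> T"
  shows "christoffel G y 0 u = 0" "christoffel G y u 0 = 0" "christoffel H z 0 v = 0" "christoffel H z v 0 = 0"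
    "H z 0 v = 0" "H z v 0 = 0" "ddir f y 0 = 0" "B.dG y u u' 0 = 0" "F.dG z v v' 0 = 0"
  using bilinear_lzero bilinear_rzero B.bilinear_christoffel[OF assms(1)] F.bilinear_christoffel[OF assms(2)]
    F.bilinear_G[OF assms(2)] linear_0 B.linear_ddir_smooth[OF smooth_f assms(1)]
    B.linear_dG3[OF assms(1)] F.linear_dG3[OF assms(2)] by metis+

section \<open>Curvature and Hessian on vertical vectors\<close>

lemma ddir_christoffel_vertical:
  assumes y: "y \<in> S" and z: "z \<in> T"
  shows "ddir (\<lambda>p. christoffel W p (0, u) (0, v)) (y, z) w =
     (- (ddir f y (fst w) * H z u v + f y * F.dG z u v (snd w)) *\<^sub>R B.grad f y
        - (f y * H z u v) *\<^sub>R ddir (B.grad f) y (fst w),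
      ddir (\<lambda>z. christoffel H z u v) z (snd w))"
proof -
  have "ddir (\<lambda>p. christoffel W p (0, u) (0, v)) (y, z) w =
    ddir (\<lambda>p. (- (f (fst p) * H (snd p) u v) *\<^sub>R B.grad f (fst p), christoffel H (snd p) u v)) (y, z) w"
    by (rule ddir_cong_open[OF open_ST]) (use y z in \<open>auto simp: christoffel_W zero_simps\<close>)
  also have "\<dots> = (\<lambda>w. (- (ddir f y (fst w) * H z u v + f y * F.dG z u v (snd w)) *\<^sub>R B.grad f y
        - (f y * H z u v) *\<^sub>R ddir (B.grad f) y (fst w),
      ddir (\<lambda>z. christoffel H z u v) z (snd w))) w"
    by (rule ddir_eqI)
       (auto intro!: derivative_eq_intros has_derivative_fst_comp[OF has_derivative_ddir[OF B.grad_diff[OF smooth_f y]]]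
       has_derivative_snd_comp[OF F.dG_has_derivative[OF z]] has_derivative_fst_comp[OF f_has_derivative[OF y]]
       has_derivative_snd_comp[OF has_derivative_ddir[OF F.christoffel_diff[OF z]]] simp: algebra_simps)
  finally show ?thesis .
qed

text \<open>Only the diagonal blocks of \<open>w \<mapsto> R(w, u) v\<close> enter the Ricci trace.\<close>

lemma local_riemann_W_horizontal:
  assumes y: "y \<in> S" and z: "z \<in> T"
  shows "fst (local_riemann W (y, z) (w, 0) (0, u) (0, v)) =
    - (f y * H z u v) *\<^sub>R (ddir (B.grad f) y w + christoffel G y w (B.grad f y))"
proof -
  note zs = zero_simps[OF y z]
  \<comment> \<open>The mixed Christoffel vector is \<open>(0, (df w / f) v)\<close>; it depends on
    the base point alone, so its vertical derivative vanishes.\<close>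
  have 2: "ddir (\<lambda>p. christoffel W p (w, 0) (0, v)) (y, z) (0, u) = 0"
  proof -
    have "ddir (\<lambda>p. christoffel W p (w, 0) (0, v)) (y, z) (0, u) =
      ddir (\<lambda>p. (0, (ddir f (fst p) w / f (fst p)) *\<^sub>R v)) (y, z) (0, u)"
      by (rule ddir_cong_open[OF open_ST]) (use y z in \<open>auto simp: christoffel_W zero_simps\<close>)
    also have "\<dots> = (\<lambda>h. (0, ((ddir (\<lambda>y. ddir f y w) y (fst h) * f y - ddir f y w * ddir f y (fst h)) / (f y * f y)) *\<^sub>R v)) (0, u)"
      using f_pos[OF y]
      by (intro ddir_eqI)
         (auto intro!: derivative_eq_intros has_derivative_fst_comp[OF smooth_on_has_derivative[OF smooth_on_ddir[OF smooth_f] y]]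
         has_derivative_fst_comp[OF f_has_derivative[OF y]] simp: field_simps)
    also have "\<dots> = 0"
      by (simp add: zs zero_prod_def linear_0[OF linear_ddir[OF smooth_on_differentiable[OF smooth_on_ddir[OF smooth_f] y]]])
    finally show ?thesis .
  qed
  show ?thesis
    unfolding local_riemann_def 2 using f_pos[OF y]
    by (simp add: ddir_christoffel_vertical[OF y z] christoffel_W[OF y z] zs bilinear_rmul[OF B.bilinear_christoffel[OF y]] bilinear_rneg[OF B.bilinear_christoffel[OF y]]
      bilinear_rmul[OF F.bilinear_G[OF z]] algebra_simps)
qed

text \<open>The horizontal part \<open>- f H(u, v) grad f\<close> of the inner connection term
  returns to the fiber with the factor \<open>df / f\<close>; \<open>f\<close> cancels and the
  squared length of the gradient, \<open>ddir f y (B.grad f y)\<close>, remains.\<close>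

lemma local_riemann_W_vertical:
  assumes y: "y \<in> S" and z: "z \<in> T"
  shows "snd (local_riemann W (y, z) (0, w) (0, u) (0, v)) =
    local_riemann H z w u v - (H z u v * ddir f y (B.grad f y)) *\<^sub>R w + (H z w v * ddir f y (B.grad f y)) *\<^sub>R u"
proof -
  note zs = zero_simps[OF y z]
  show ?thesis
    unfolding local_riemann_def using f_pos[OF y]
    by (simp add: ddir_christoffel_vertical[OF y z] christoffel_W[OF y z] zs linear_neg[OF B.linear_ddir_smooth[OF smooth_f y]] linear_cmul[OF B.linear_ddir_smooth[OF smooth_f y]] algebra_simps)
qed

text \<open>In the vertical block the multiple of the identity contributes the fiber dimension and
  the rank-one map \<open>w \<mapsto> H(w, v) u\<close> takes away one, hence
  \<open>real DIM('m) - 1\<close>. The horizontal block gives the Laplacian of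
  \<open>f\<close>.\<close>

lemma ricci_W_vertical:
  assumes y: "y \<in> S" and z: "z \<in> T"
  shows "trace (\<lambda>w. local_riemann W (y, z) w (0, u) (0, v)) = trace (\<lambda>w. local_riemann H z w u v)
    - H z u v * (f y * trace (\<lambda>w. ddir (B.grad f) y w + christoffel G y w (B.grad f y))
        + (real DIM('m) - 1) * ddir f y (B.grad f y))"
proof -
  define N where "N w = ddir (B.grad f) y w + christoffel G y w (B.grad f y)" for w
  define s where "s = ddir f y (B.grad f y)"
  have "(\<Sum>i\<in>Basis. (H z i v * s) * (u \<bullet> i)) = (\<Sum>i\<in>Basis. (u \<bullet> i) *\<^sub>R H z i v) * s"
    by (subst sum_distrib_right) (simp add: mult_ac)
  also have "\<dots> = H z u v * s"
    using linear_euclidean_sum[OF posdefD(5)[OF F.posdef_G[OF z]], of u v] by simp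
  finally have c: "(\<Sum>i\<in>Basis. (H z i v * s) * (u \<bullet> i)) = H z u v * s" .
  have 1: "trace (\<lambda>w. - (f y * H z u v) *\<^sub>R N w) = - (f y * H z u v) * trace N"
    unfolding trace_def by (subst sum_distrib_left) simp
  have 2: "trace (\<lambda>w. local_riemann H z w u v - (H z u v * s) *\<^sub>R w + (H z w v * s) *\<^sub>R u)
    = trace (\<lambda>w. local_riemann H z w u v) - real DIM('m) * (H z u v * s) + H z u v * s"
    unfolding c[symmetric] trace_def by (simp add: inner_diff_left inner_add_left sum.distrib sum_subtractf)
  show ?thesis
    unfolding trace_prod local_riemann_W_horizontal[OF y z] local_riemann_W_vertical[OF y z]
      N_def[symmetric] s_def[symmetric] 1 2 by (simp add: algebra_simps)
qed

text \<open>A lift is constant along fibers, so the second derivative vanishes; what remains is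
  \<open>- dP\<close> of the horizontal part \<open>- f H(u, v) grad f\<close> of the
  connection.\<close>

lemma hessian_W_vertical:
  assumes P: "smooth_on P S" and h: "\<And>y z. y \<in> S \<Longrightarrow> z \<in> T \<Longrightarrow> h (y, z) = P y"
    and y: "y \<in> S" and z: "z \<in> T"
  shows "ddir (\<lambda>p. ddir h p (0, v)) (y, z) (0, u) - ddir h (y, z) (christoffel W (y, z) (0, u) (0, v))
    = f y * H z u v * ddir P y (B.grad f y)"
proof -
  have dh: "ddir h (y, z) w = ddir P y (fst w)" if "y \<in> S" "z \<in> T" for y z w
  proof -
    have "ddir h (y, z) w = ddir (\<lambda>p. P (fst p)) (y, z) w"
      by (rule ddir_cong_open[OF open_ST]) (use that h in auto)
    also have "\<dots> = ddir P y (fst w)"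
      by (rule ddir_eqI[OF has_derivative_fst_comp[OF smooth_on_has_derivative[OF P that(1)]]])
    finally show ?thesis .
  qed
  have "ddir (\<lambda>p. ddir h p (0, v)) (y, z) (0, u) = ddir (\<lambda>p. 0::real) (y, z) (0, u)"
    by (rule ddir_cong_open[OF open_ST]) (use y z in \<open>auto simp: dh linear_0[OF B.linear_ddir_smooth[OF P]]\<close>)
  also have "\<dots> = 0" by (simp add: ddir_def)
  finally show ?thesis
    by (simp add: dh y z christoffel_W[OF y z] zero_simps[OF y z] linear_neg[OF B.linear_ddir_smooth[OF P y]]
        linear_cmul[OF B.linear_ddir_smooth[OF P y]])
qed

lemma scalar_curvature_fibre:
  assumes P: "smooth_on P S" and h: "\<And>y z. y \<in> S \<Longrightarrow> z \<in> T \<Longrightarrow> h (y, z) = P y"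
    and y: "y \<in> S" and z: "z \<in> T" and E: "orthonormal_frame (G y) E"
    and soliton: "\<And>u v. trace (\<lambda>w. local_riemann W (y, z) w u v)
      + (ddir (\<lambda>p. ddir h p v) (y, z) u - ddir h (y, z) (christoffel W (y, z) u v)) = lam * W (y, z) u v"
  shows "trace (\<lambda>u. sharp (H z) (\<lambda>v. trace (\<lambda>w. local_riemann H z w u v))) =
    real DIM('m) * (f y * (\<Sum>e\<in>E. B.hess f y e e) + (real DIM('m) - 1) * ddir f y (B.grad f y)
      - f y * ddir P y (B.grad f y) + lam * (f y)\<^sup>2)"
proof -
  define \<mu> where "\<mu> = f y * (\<Sum>e\<in>E. B.hess f y e e) + (real DIM('m) - 1) * ddir f y (B.grad f y)
      - f y * ddir P y (B.grad f y) + lam * (f y)\<^sup>2"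
  have "trace (\<lambda>w. local_riemann H z w u v) = \<mu> * H z u v" for u v
    using soliton[of "(0, u)" "(0, v)"] hessian_W_vertical[OF P h y z, of v u]
    unfolding ricci_W_vertical[OF y z] W_eq[OF y z] B.laplacian_orthonormal_frame[OF smooth_f y E]
    by (simp add: \<mu>_def algebra_simps bilinear_lzero[OF B.bilinear_G[OF y]])
  then have "sharp (H z) (\<lambda>v. trace (\<lambda>w. local_riemann H z w u v)) = \<mu> *\<^sub>R u" for u
    by (intro sharp_eqI[OF F.posdef_G[OF z]]) (simp add: bilinear_lmul[OF F.bilinear_G[OF z]])
  then show ?thesis by (simp add: trace_def \<mu>_def[symmetric])
qed

end

section \<open>Charts\<close>

lemma chart:
  fixes A :: "('a::{t2_space,second_countable_topology}, 'e::euclidean_space) chart set"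
  assumes "smooth_manifold A" "c \<in> A"
  shows chart_open: "open (fst c)" and chart_image_open: "open (snd c ` fst c)"
    and chart_homeomorphism: "homeomorphism (fst c) (snd c ` fst c) (snd c) (chart_inv c)"
    and chart_inv_in: "y \<in> snd c ` fst c \<Longrightarrow> chart_inv c y \<in> fst c"
    and chart_right_inverse: "y \<in> snd c ` fst c \<Longrightarrow> snd c (chart_inv c y) = y"
    and chart_left_inverse: "p \<in> fst c \<Longrightarrow> chart_inv c (snd c p) = p"
    and chart_inj: "inj_on (snd c) (fst c)"
    and chart_transition: "d \<in> A \<Longrightarrow> smooth_on (snd d \<circ> chart_inv c) (snd c ` (fst c \<inter> fst d))"
proof -
  show hom: "homeomorphism (fst c) (snd c ` fst c) (snd c) (chart_inv c)"
    and "open (fst c)" "open (snd c ` fst c)"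
    and "d \<in> A \<Longrightarrow> smooth_on (snd d \<circ> chart_inv c) (snd c ` (fst c \<inter> fst d))"
    using assms unfolding smooth_manifold_def by blast+
  show "y \<in> snd c ` fst c \<Longrightarrow> chart_inv c y \<in> fst c"
    unfolding chart_inv_def by (rule inv_into_into)
  show "y \<in> snd c ` fst c \<Longrightarrow> snd c (chart_inv c y) = y"
    unfolding chart_inv_def by (rule f_inv_into_f)
  show left: "p \<in> fst c \<Longrightarrow> chart_inv c (snd c p) = p" for p
    using homeomorphism_apply1[OF hom] .
  then show "inj_on (snd c) (fst c)" by (rule inj_on_inverseI)
qed

lemma chart_exists:
  assumes "smooth_manifold A"
  obtains c where "c \<in> A" "p \<in> fst c"
proof -
  have "p \<in> (\<Union>c\<in>A. fst c)" using assms unfolding smooth_manifold_def by blast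
  then show ?thesis using that by blast
qed

lemma chart_image_Int_open:
  fixes A :: "('a::{t2_space,second_countable_topology}, 'e::euclidean_space) chart set"
  assumes A: "smooth_manifold A" "c \<in> A" and V: "open V"
  shows "open (snd c ` (fst c \<inter> V))"
proof -
  have "snd c ` (fst c \<inter> V) = snd c ` fst c \<inter> chart_inv c -` V"
    using chart_left_inverse[OF A] by force
  then show ?thesis
    using continuous_open_preimage[OF homeomorphism_cont2[OF chart_homeomorphism[OF A]] chart_image_open[OF A] V] by simp
qed

lemma metric_field_in_chart:
  fixes A :: "('a::{t2_space,second_countable_topology}, 'e::euclidean_space) chart set"
  assumes "riemannian_manifold A g" "c \<in> A"
  shows "metric_field (snd c ` fst c) (in_chart g c)"
proof
  have A: "smooth_manifold A" and g: "riemannian_metric A g"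
    using assms(1) by (auto simp: riemannian_manifold_def)
  show "open (snd c ` fst c)" by (rule chart_image_open[OF A assms(2)])
  show "posdef (in_chart g c y)" if "y \<in> snd c ` fst c" for y
    using g assms(2) chart_inv_in[OF A assms(2) that]
    unfolding riemannian_metric_def posdef_def in_chart_def by blast
  show "smooth_on (\<lambda>y. in_chart g c y u v) (snd c ` fst c)" for u v
    using g assms(2) unfolding riemannian_metric_def in_chart_def by blast
qed

section \<open>Product charts and the warped metric in coordinates\<close>

abbreviation prod_chart :: "('a, 'e) chart \<Rightarrow> ('b, 'f) chart \<Rightarrow> ('a \<times> 'b, 'e \<times> 'f) chart" where
  "prod_chart c d \<equiv> (fst c \<times> fst d, map_prod (snd c) (snd d))"

lemma prod_chart_in_prod_atlas: "c \<in> A \<Longrightarrow> d \<in> B \<Longrightarrow> prod_chart c d \<in> prod_atlas A B"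
  unfolding prod_atlas_def by blast

lemma chart_inv_prod_chart:
  fixes A :: "('a::{t2_space,second_countable_topology}, 'e::euclidean_space) chart set"
    and B :: "('b::{t2_space,second_countable_topology}, 'f::euclidean_space) chart set"
  assumes A: "smooth_manifold A" "c \<in> A" and B: "smooth_manifold B" "d \<in> B"
    and y: "y \<in> snd c ` fst c" and z: "z \<in> snd d ` fst d"
  shows "chart_inv (prod_chart c d) (y, z) = (chart_inv c y, chart_inv d z)"
  unfolding chart_inv_def[of "prod_chart c d"]
proof (rule inv_into_f_eq)
  show "inj_on (snd (prod_chart c d)) (fst (prod_chart c d))"
    using map_prod_inj_on[OF chart_inj[OF A] chart_inj[OF B]] by simp
qed (use chart_inv_in[OF A y] chart_inv_in[OF B z] chart_right_inverse[OF A y] chart_right_inverse[OF B z] in auto)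

text \<open>\<open>pullback\<close> evaluates in a chart \<open>d\<close> picked by choice. On
  \<open>N\<close> the map \<open>F\<close> reads as the linear \<open>\<pi>\<close> in
  \<open>C\<close> and \<open>c\<close>, so its derivative into \<open>d\<close> is that of the
  transition map after \<open>\<pi>\<close>, and the transformation rule of \<open>g\<close> leads
  back to \<open>c\<close>.\<close>

lemma pullback_eq:
  fixes A :: "('a::{t2_space,second_countable_topology}, 'e::euclidean_space) chart set"
    and C :: "('c, 'k::euclidean_space) chart"
  assumes A: "riemannian_manifold A g" "c \<in> A"
    and N: "open N" "snd C p \<in> N"
    and \<pi>: "bounded_linear \<pi>" "\<And>x. x \<in> N \<Longrightarrow> \<pi> x \<in> snd c ` fst c"
      "\<And>x. x \<in> N \<Longrightarrow> F (chart_inv C x) = chart_inv c (\<pi> x)"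
    and p: "F p \<in> fst c" "\<pi> (snd C p) = snd c (F p)"
  shows "pullback A F g C p u v = g c (F p) (\<pi> u) (\<pi> v)"
proof -
  have M: "smooth_manifold A" and g: "riemannian_metric A g"
    using A(1) by (auto simp: riemannian_manifold_def)
  define d where "d = (SOME d. d \<in> A \<and> F p \<in> fst d)"
  have d: "d \<in> A" "F p \<in> fst d"
    using someI_ex[of "\<lambda>d. d \<in> A \<and> F p \<in> fst d"] chart_exists[OF M] by (metis d_def)+
  define O' where "O' = snd c ` (fst c \<inter> fst d)"
  define \<kappa> where "\<kappa> = snd d \<circ> chart_inv c"
  have O': "open O'" "snd c (F p) \<in> O'"
    using chart_image_Int_open[OF M A(2) chart_open[OF M d(1)]] p d by (auto simp: O'_def)
  have "smooth_on \<kappa> O'" unfolding \<kappa>_def O'_def by (rule chart_transition[OF M A(2) d(1)])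
  then have d\<kappa>: "(\<kappa> has_derivative ddir \<kappa> (snd c (F p))) (at (\<pi> (snd C p)))"
    using smooth_on_has_derivative O' p(2) by metis
  have "((\<lambda>x. \<kappa> (\<pi> x)) has_derivative (\<lambda>u. ddir \<kappa> (snd c (F p)) (\<pi> u))) (at (snd C p))"
    using has_derivative_compose[OF bounded_linear_imp_has_derivative[OF \<pi>(1)] d\<kappa>] .
  moreover have "\<kappa> (\<pi> x) = (snd d \<circ> F \<circ> chart_inv C) x" if "x \<in> N" for x
    using \<pi>(3)[OF that] by (simp add: \<kappa>_def)
  ultimately have "((snd d \<circ> F \<circ> chart_inv C) has_derivative (\<lambda>u. ddir \<kappa> (snd c (F p)) (\<pi> u))) (at (snd C p))"
    using has_derivative_transform_within_open[OF _ N] by blast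
  then have L: "frechet_derivative (snd d \<circ> F \<circ> chart_inv C) (at (snd C p)) = (\<lambda>u. ddir \<kappa> (snd c (F p)) (\<pi> u))"
    using frechet_derivative_at by metis
  have "g c (F p) (\<pi> u) (\<pi> v) = (let L = frechet_derivative (snd d \<circ> chart_inv c) (at (snd c (F p)))
                     in g d (F p) (L (\<pi> u)) (L (\<pi> v)))"
    using g A(2) d p(1) unfolding riemannian_metric_def by blast
  then show ?thesis
    unfolding pullback_def d_def[symmetric] Let_def L by (simp add: ddir_def \<kappa>_def)
qed

lemma in_chart_warped_metric:
  fixes AB :: "('a::{t2_space,second_countable_topology}, 'e::euclidean_space) chart set"
    and AF :: "('b::{t2_space,second_countable_topology}, 'f::euclidean_space) chart set"
  assumes B: "riemannian_manifold AB gB" "c \<in> AB" and F: "riemannian_manifold AF gF" "d \<in> AF"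
    and y: "y \<in> snd c ` fst c" and z: "z \<in> snd d ` fst d"
  shows "in_chart (warped_metric AB gB f AF gF) (prod_chart c d) (y, z) u v =
    in_chart gB c y (fst u) (fst v) + ((f \<circ> chart_inv c) y)\<^sup>2 * in_chart gF d z (snd u) (snd v)"
proof -
  have MB: "smooth_manifold AB" and MF: "smooth_manifold AF"
    using B(1) F(1) by (auto simp: riemannian_manifold_def)
  define N where "N = (snd c ` fst c) \<times> (snd d ` fst d)"
  note inv = chart_inv_prod_chart[OF MB B(2) MF F(2)]
  note yz = chart_inv_in[OF MB B(2) y] chart_inv_in[OF MF F(2) z]
    chart_right_inverse[OF MB B(2) y] chart_right_inverse[OF MF F(2) z]
  have N: "open N" unfolding N_def
    by (intro open_Times chart_image_open[OF MB B(2)] chart_image_open[OF MF F(2)])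
  have "pullback AB fst gB (prod_chart c d) (chart_inv c y, chart_inv d z) u v
      = gB c (fst (chart_inv c y, chart_inv d z)) (fst u) (fst v)"
    by (rule pullback_eq[OF B N _ bounded_linear_fst]) (use y z yz inv in \<open>auto simp: N_def\<close>)
  moreover have "pullback AF snd gF (prod_chart c d) (chart_inv c y, chart_inv d z) u v
      = gF d (snd (chart_inv c y, chart_inv d z)) (snd u) (snd v)"
    by (rule pullback_eq[OF F N _ bounded_linear_snd]) (use y z yz inv in \<open>auto simp: N_def\<close>)
  ultimately show ?thesis
    unfolding in_chart_def inv[OF y z] warped_metric_def by simp
qed

section \<open>Solitons\<close>

text \<open>The separation of variables: \<open>d\<close> and \<open>q\<close> occur only on the
  left, \<open>c\<close>, \<open>p\<close> and \<open>E\<close> only on the right. The product chart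
  at \<open>(p, q)\<close> reduces it to \<open>scalar_curvature_fibre\<close>.\<close>

lemma soliton_fibre_scalar_curvature:
  fixes AB :: "('a::{t2_space,second_countable_topology}, 'n::euclidean_space) chart set"
    and AF :: "('b::{t2_space,second_countable_topology}, 'm::euclidean_space) chart set"
  assumes sol: "gradient_ricci_soliton_warped_product AB gB f AF gF \<phi> lam"
    and c: "c \<in> AB" and d: "d \<in> AF" and p: "p \<in> fst c" and q: "q \<in> fst d"
    and E: "orthonormal_frame (in_chart gB c (snd c p)) E"
  defines "F \<equiv> f \<circ> chart_inv c" and "y \<equiv> snd c p" and "grad \<equiv> metric_field.grad (in_chart gB c)"
  shows "scalar_curvature gF d q = real DIM('m) *
    (F y * (\<Sum>e\<in>E. metric_field.hess (in_chart gB c) F y e e) + (real DIM('m) - 1) * ddir F y (grad F y)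
      - F y * ddir (\<phi> \<circ> chart_inv c) y (grad F y) + lam * (F y)\<^sup>2)"
proof -
  have B: "riemannian_manifold AB gB" and F: "riemannian_manifold AF gF"
    and f: "smooth_function AB f" and f_pos: "\<And>p. f p > 0" and \<phi>: "smooth_function AB \<phi>"
    and S: "gradient_ricci_soliton (prod_atlas AB AF) (warped_metric AB gB f AF gF) (\<phi> \<circ> fst) lam"
    using sol unfolding gradient_ricci_soliton_warped_product_def by auto
  have MB: "smooth_manifold AB" and MF: "smooth_manifold AF"
    using B F by (auto simp: riemannian_manifold_def)
  define z where "z = snd d q"
  define W where "W = in_chart (warped_metric AB gB f AF gF) (prod_chart c d)"
  define h where "h = (\<phi> \<circ> fst) \<circ> chart_inv (prod_chart c d)"
  have yz: "y \<in> snd c ` fst c" "z \<in> snd d ` fst d" "chart_inv d z = q"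
    using p q chart_left_inverse[OF MF d q] by (auto simp: y_def z_def)
  interpret B: metric_field "snd c ` fst c" "in_chart gB c" by (rule metric_field_in_chart[OF B c])
  interpret F: metric_field "snd d ` fst d" "in_chart gF d" by (rule metric_field_in_chart[OF F d])
  interpret warped_field "snd c ` fst c" "in_chart gB c" "snd d ` fst d" "in_chart gF d" F W
  proof
    show "smooth_on F (snd c ` fst c)" using f c by (simp add: smooth_function_def F_def)
    show "F y > 0" for y using f_pos by (simp add: F_def)
    show "W (y, z) u v = in_chart gB c y (fst u) (fst v) + (F y)\<^sup>2 * in_chart gF d z (snd u) (snd v)"
      if "y \<in> snd c ` fst c" "z \<in> snd d ` fst d" for y z u v
      unfolding W_def F_def by (rule in_chart_warped_metric[OF B c F d that])
  qed
  have P: "smooth_on (\<phi> \<circ> chart_inv c) (snd c ` fst c)" using \<phi> c by (simp add: smooth_function_def)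
  have hP: "h (y, z) = (\<phi> \<circ> chart_inv c) y" if "y \<in> snd c ` fst c" "z \<in> snd d ` fst d" for y z
    using chart_inv_prod_chart[OF MB c MF d that] by (simp add: h_def)
  have "trace (\<lambda>w. local_riemann W (y, z) w u v)
      + (ddir (\<lambda>p. ddir h p v) (y, z) u - ddir h (y, z) (christoffel W (y, z) u v)) = lam * W (y, z) u v" for u v
  proof -
    have "ricci (warped_metric AB gB f AF gF) (prod_chart c d) (p, q) u v
      + hessian (warped_metric AB gB f AF gF) (\<phi> \<circ> fst) (prod_chart c d) (p, q) u v
      = lam * warped_metric AB gB f AF gF (prod_chart c d) (p, q) u v"
      using S prod_chart_in_prod_atlas[OF c d] p q unfolding gradient_ricci_soliton_def by fastforce
    moreover have "chart_inv (prod_chart c d) (y, z) = (p, q)"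
      using chart_inv_prod_chart[OF MB c MF d yz(1,2)] chart_left_inverse[OF MB c p] yz(3) by (simp add: y_def)
    then have "warped_metric AB gB f AF gF (prod_chart c d) (p, q) u v = W (y, z) u v"
      by (simp add: W_def in_chart_def)
    ultimately show ?thesis
      unfolding ricci_def hessian_def Let_def W_def[symmetric] h_def[symmetric] by (simp add: y_def z_def)
  qed
  from scalar_curvature_fibre[OF P hP yz(1,2) E[folded y_def] this]
  have "trace (\<lambda>u. sharp (in_chart gF d z) (\<lambda>v. trace (\<lambda>w. local_riemann (in_chart gF d) z w u v))) =
    real DIM('m) * (F y * (\<Sum>e\<in>E. B.hess F y e e) + (real DIM('m) - 1) * ddir F y (B.grad F y)
      - F y * ddir (\<phi> \<circ> chart_inv c) y (B.grad F y) + lam * (F y)\<^sup>2)" .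
  moreover have "in_chart gF d z = gF d q" by (simp add: in_chart_def yz(3))
  ultimately show ?thesis
    unfolding scalar_curvature_def grad_def ricci_def z_def by (simp add: fun_eq_iff)
qed

lemma continuous_on_smooth_function:
  fixes A :: "('a::{t2_space,second_countable_topology}, 'e::euclidean_space) chart set"
  assumes A: "smooth_manifold A" and f: "smooth_function A f"
  shows "continuous_on UNIV f"
proof -
  have "continuous_on (fst c) f" if c: "c \<in> A" for c
  proof -
    have "smooth_on (f \<circ> chart_inv c) (snd c ` fst c)" using f c by (simp add: smooth_function_def)
    then have "continuous_on (snd c ` fst c) (f \<circ> chart_inv c)"
      unfolding smooth_on_def by (metis Ck_on.simps(1))
    then have "continuous_on (fst c) ((f \<circ> chart_inv c) \<circ> snd c)"
      using continuous_on_compose homeomorphism_cont1[OF chart_homeomorphism[OF A c]] by blast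
    then show ?thesis
      by (rule continuous_on_eq) (simp add: chart_left_inverse[OF A c])
  qed
  then have "continuous_on (\<Union>c\<in>A. fst c) f"
    using chart_open[OF A] by (intro continuous_on_open_UN)
  moreover have "(\<Union>c\<in>A. fst c) = UNIV" using A unfolding smooth_manifold_def by blast
  ultimately show ?thesis by simp
qed

theorem corollary1:
  fixes AB :: "('a::{t2_space,second_countable_topology}, 'n::euclidean_space) chart set"
    and gB :: "('a, 'n) tensor2" and f :: "'a \<Rightarrow> real"
    and AF :: "('b::{t2_space,second_countable_topology}, 'm::euclidean_space) chart set"
    and gF :: "('b, 'm) tensor2"
  assumes base_compact: "compact (UNIV :: 'a set)"
    and f_nonconstant: "\<not> f constant_on UNIV"
    and fiber_dim: "DIM('m) \<ge> 2"
    and fiber_scal: "\<forall>d\<in>AF. \<forall>q\<in>fst d. scalar_curvature gF d q \<le> 0"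
  shows "\<nexists>\<phi> lam. gradient_ricci_soliton_warped_product AB gB f AF gF \<phi> lam"
proof
  assume "\<exists>\<phi> lam. gradient_ricci_soliton_warped_product AB gB f AF gF \<phi> lam"
  then obtain \<phi> lam where sol: "gradient_ricci_soliton_warped_product AB gB f AF gF \<phi> lam" by blast
  then have B: "riemannian_manifold AB gB" and F: "riemannian_manifold AF gF"
    and f: "smooth_function AB f" and f_pos: "\<And>p. f p > 0" and \<phi>: "smooth_function AB \<phi>"
    unfolding gradient_ricci_soliton_warped_product_def by auto
  then have MB: "smooth_manifold AB" and MF: "smooth_manifold AF"
    by (auto simp: riemannian_manifold_def)
  have contf: "continuous_on UNIV f" by (rule continuous_on_smooth_function[OF MB f])
  obtain d q where d: "d \<in> AF" "q \<in> fst d" using chart_exists[OF MF] by metis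
  \<comment> \<open>One fiber point is fixed for the whole proof, so \<open>\<mu>\<close> is
    constant by definition and \<open>eq\<close> below holds with the same value at every base
    point.\<close>
  define \<mu> where "\<mu> = scalar_curvature gF d q / real DIM('m)"
  have \<mu>: "\<mu> \<le> 0" using fiber_scal d by (simp add: \<mu>_def divide_le_0_iff)
  obtain pmax where pmax: "\<And>p. f p \<le> f pmax"
    using continuous_attains_sup[OF base_compact _ contf] by auto
  obtain pmin where pmin: "\<And>p. f pmin \<le> f p"
    using continuous_attains_inf[OF base_compact _ contf] by auto

  let ?F = "\<lambda>c. f \<circ> chart_inv c"
  let ?P = "\<lambda>c. \<phi> \<circ> chart_inv c"
  let ?grad = "\<lambda>c. metric_field.grad (in_chart gB c)"
  let ?hess = "\<lambda>c. metric_field.hess (in_chart gB c) (?F c)"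
  have smF: "smooth_on (?F c) (snd c ` fst c)" and smP: "smooth_on (?P c) (snd c ` fst c)" if "c \<in> AB" for c
    using f \<phi> that by (auto simp: smooth_function_def)
  have Fp: "?F c (snd c p) = f p" if "c \<in> AB" "p \<in> fst c" for c p
    using chart_left_inverse[OF MB that] by simp
  have eq: "\<mu> = f p * (\<Sum>e\<in>E. ?hess c (snd c p) e e)
      + (real DIM('m) - 1) * ddir (?F c) (snd c p) (?grad c (?F c) (snd c p))
      - f p * ddir (?P c) (snd c p) (?grad c (?F c) (snd c p)) + lam * (f p)\<^sup>2"
    if "c \<in> AB" "p \<in> fst c" "orthonormal_frame (in_chart gB c (snd c p)) E" for c p E
    using soliton_fibre_scalar_curvature[OF sol that(1) d(1) that(2) d(2) that(3)] Fp[OF that(1,2)]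
    by (simp add: \<mu>_def)
  \<comment> \<open>The sign \<open>s\<close> treats maxima (\<open>s = 1\<close>) and minima
    (\<open>s = -1\<close>) together. There both gradient terms vanish and \<open>L\<close> is the
    Laplacian of \<open>f\<close>; for \<open>s = 0\<close> the sign condition is trivial and
    \<open>L\<close> is solved from the equation.\<close>
  have critical: "\<exists>L. \<mu> = f p * L + lam * (f p)\<^sup>2 \<and> s * L \<le> 0"
    if ext: "\<And>p'. s * f p' \<le> s * f p" for s p
  proof -
    obtain c where c: "c \<in> AB" "p \<in> fst c" using chart_exists[OF MB] by metis
    define y where "y = snd c p"
    have y: "y \<in> snd c ` fst c" using c by (simp add: y_def)
    interpret metric_field "snd c ` fst c" "in_chart gB c" by (rule metric_field_in_chart[OF B c(1)])
    note F = smF[OF c(1)]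
    obtain E where E: "orthonormal_frame (in_chart gB c y) E" using orthonormal_frame_exists[OF posdef_G[OF y]] by blast
    have test: "s * ddir (?F c) y e = 0 \<and> s * ddir (\<lambda>y. ddir (?F c) y e) y e \<le> 0" for e
    proof -
      have h: "((\<lambda>y. s * ?F c y) has_derivative (\<lambda>w. s * ddir (?F c) x w)) (at x)" if "x \<in> snd c ` fst c" for x
        using smooth_on_has_derivative[OF F that] by (rule has_derivative_mult_right)
      have dh: "((\<lambda>x. s * ddir (?F c) x e) has_derivative (\<lambda>w. s * ddir (\<lambda>y. ddir (?F c) y e) y w)) (at y)"
        using smooth_on_has_derivative[OF smooth_on_ddir[OF F] y] by (rule has_derivative_mult_right)
      have "s * ?F c x \<le> s * ?F c y" for x using ext Fp[OF c] by (simp add: y_def)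
      from second_derivative_test_max[OF open_S y h dh this] show ?thesis by blast
    qed
    show ?thesis
    proof (cases "s = 0")
      case True
      then show ?thesis using f_pos[of p] by (intro exI[of _ "(\<mu> - lam * (f p)\<^sup>2) / f p"]) simp
    next
      case False
      then have dF: "ddir (?F c) y e = 0" for e using test by auto
      have "?grad c (?F c) y = 0"
        by (rule posdef_nondegenerate[OF posdef_G[OF y]])
           (simp add: G_grad[OF F y] dF bilinear_lzero[OF bilinear_G[OF y]])
      then have "\<mu> = f p * (\<Sum>e\<in>E. ?hess c y e e) + lam * (f p)\<^sup>2"
        using eq[OF c E[unfolded y_def]] linear_0[OF linear_ddir_smooth[OF smP[OF c(1)] y]]
        by (simp add: dF y_def[symmetric])
      moreover have "s * (\<Sum>e\<in>E. ?hess c y e e) \<le> 0"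
        unfolding sum_distrib_left using test by (intro sum_nonpos) (simp add: hess_def dF)
      ultimately show ?thesis by blast
    qed
  qed
  obtain L1 where L1: "\<mu> = f pmax * L1 + lam * (f pmax)\<^sup>2" "L1 \<le> 0"
    using critical[of 1 pmax] pmax by auto
  obtain L2 where L2: "\<mu> = f pmin * L2 + lam * (f pmin)\<^sup>2" "L2 \<ge> 0"
    using critical[of "-1" pmin] pmin by auto
  have ne: "f pmin < f pmax"
  proof (rule ccontr)
    assume "\<not> f pmin < f pmax"
    then have "f p = f pmax" for p using pmin[of p] pmax[of p] by linarith
    then show False using f_nonconstant by (auto simp: constant_on_def)
  qed
  have 1: "\<mu> \<le> lam * (f pmax)\<^sup>2" using L1 f_pos[of pmax] by (simp add: mult_nonneg_nonpos)
  have 2: "lam * (f pmin)\<^sup>2 \<le> \<mu>" using L2 f_pos[of pmin] by simp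
  have lt: "(f pmin)\<^sup>2 < (f pmax)\<^sup>2" using ne f_pos[of pmin] by (intro power_strict_mono) auto
  \<comment> \<open>As \<open>f pmin\<close> is positive, \<open>lam\<close> is not positive; a
    negative \<open>lam\<close> would reverse the strict order of the squares, against
    \<open>1\<close> and \<open>2\<close>.\<close>
  have "lam * (f pmin)\<^sup>2 \<le> 0" using 2 \<mu> by linarith
  then have "lam \<le> 0" using f_pos[of pmin] by (simp add: mult_le_0_iff)
  moreover have "\<not> lam < 0"
  proof
    assume "lam < 0"
    then have "lam * (f pmax)\<^sup>2 < lam * (f pmin)\<^sup>2" using lt by simp
    then show False using 1 2 by linarith
  qed
  ultimately have lam: "lam = 0" by simp
  then have \<mu>0: "\<mu> = 0" using 1 2 by simp

  \<comment> \<open>The maximum set is open by the strong maximum principle and closed by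
    continuity, so by connectedness it contains \<open>pmin\<close>.\<close>
  have "open {p. f p = f pmax}"
  proof (subst open_subopen, rule ballI)
    fix p assume "p \<in> {p. f p = f pmax}"
    then have p: "f p = f pmax" by simp
    obtain c where c: "c \<in> AB" "p \<in> fst c" using chart_exists[OF MB] by metis
    define y where "y = snd c p"
    have y: "y \<in> snd c ` fst c" using c by (simp add: y_def)
    interpret metric_field "snd c ` fst c" "in_chart gB c" by (rule metric_field_in_chart[OF B c(1)])
    note F = smF[OF c(1)]
    note P = smP[OF c(1)]
    \<comment> \<open>Dividing the equation by \<open>f\<close> leaves the Laplacian plus this
      drift. \<open>X\<close> contains the gradient of \<open>f\<close> itself, so that the
      quadratic gradient term reads as a linear first-order term \<open>df X\<close>.\<close>
    define X where "X x = ((real DIM('m) - 1) / ?F c x) *\<^sub>R grad (?F c) x - grad (?P c) x" for x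
    have "isCont (\<lambda>x. (k / u x) *\<^sub>R v x - w x) y"
      if "u differentiable (at y)" "v differentiable (at y)" "w differentiable (at y)" "u y \<noteq> 0"
      for u :: "'n \<Rightarrow> real" and v w :: "'n \<Rightarrow> 'n" and k
      using that by (intro continuous_intros differentiable_imp_continuous_within) auto
    from this[OF smooth_on_differentiable[OF F y] grad_diff[OF F y] grad_diff[OF P y]]
    have "isCont X y" unfolding X_def using f_pos[of "chart_inv c y"] by simp
    moreover have "(\<Sum>e\<in>E. hess (?F c) x e e) + ddir (?F c) x (X x) = 0"
      if x: "x \<in> snd c ` fst c" and E: "orthonormal_frame (in_chart gB c x) E" for x E
    proof -
      obtain p' where p': "p' \<in> fst c" "x = snd c p'" using x by blast
      \<comment> \<open>Both sides are the inner product of the two gradients; the right one lets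
        the potential enter through the derivative of \<open>f\<close>.\<close>
      have sym: "ddir (?P c) x (grad (?F c) x) = ddir (?F c) x (grad (?P c) x)"
        using G_grad[OF F x] G_grad[OF P x] G_sym[OF x] by metis
      have "?F c x = f p'" using Fp[OF c(1) p'(1)] p'(2) by simp
      then have "ddir (?F c) x (X x) = (real DIM('m) - 1) / f p' * ddir (?F c) x (grad (?F c) x)
          - ddir (?P c) x (grad (?F c) x)"
        unfolding X_def sym by (simp only: linear_diff[OF linear_ddir_smooth[OF F x]]
          linear_cmul[OF linear_ddir_smooth[OF F x]] real_scaleR_def)
      moreover have "0 = f p' * (\<Sum>e\<in>E. hess (?F c) x e e)
          + (real DIM('m) - 1) * ddir (?F c) x (grad (?F c) x) - f p' * ddir (?P c) x (grad (?F c) x)"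
        using eq[OF c(1) p'(1) E[unfolded p'(2)]] by (simp add: p'(2)[symmetric] lam \<mu>0)
      ultimately have "f p' * ((\<Sum>e\<in>E. hess (?F c) x e e) + ddir (?F c) x (X x)) = 0"
        using f_pos[of p'] by (simp add: distrib_left right_diff_distrib)
      then show ?thesis using f_pos[of p'] by simp
    qed
    moreover have "?F c x \<le> ?F c y" for x using pmax p Fp[OF c] by (simp add: y_def)
    ultimately obtain \<delta> where \<delta>: "\<delta> > 0" "\<And>x. x \<in> ball y \<delta> \<Longrightarrow> ?F c x = ?F c y"
      using strong_maximum_principle_laplacian[OF y F, of X] by blast
    let ?T = "fst c \<inter> snd c -` ball y \<delta>"
    have "open ?T"
      by (rule continuous_open_preimage[OF homeomorphism_cont1[OF chart_homeomorphism[OF MB c(1)]] chart_open[OF MB c(1)] open_ball])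
    moreover have "p \<in> ?T" using c \<delta>(1) by (simp add: y_def)
    moreover have "?T \<subseteq> {p. f p = f pmax}"
    proof
      fix p' assume "p' \<in> ?T"
      then show "p' \<in> {p. f p = f pmax}"
        using \<delta>(2)[of "snd c p'"] Fp[OF c(1), of p'] Fp[OF c] p by (simp add: y_def)
    qed
    ultimately show "\<exists>T. open T \<and> p \<in> T \<and> T \<subseteq> {p. f p = f pmax}" by blast
  qed
  moreover have "closed {p. f p = f pmax}"
    using continuous_closed_preimage_constant[OF contf closed_UNIV] by simp
  moreover have "connected (UNIV :: 'a set)" using MB unfolding smooth_manifold_def by blast
  then have "\<forall>T::'a set. open T \<and> closed T \<longrightarrow> T = {} \<or> T = UNIV" by (simp add: connected_clopen)
  ultimately have "{p. f p = f pmax} = {} \<or> {p. f p = f pmax} = UNIV" by blast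
  then have "{p. f p = f pmax} = UNIV" by blast
  then have "pmin \<in> {p. f p = f pmax}" by blast
  then show False using ne by simp
qed

end
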